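(* Let $\mu,\nu>0$ be fixed, let $\rho=\nu/\mu$, and for each integer $N\ge 1$ let $H_N$ be the height of the birth-and-death process on $\{0,1,\dots,N\}$ with parameters $\mu,\nu$. Suppose that $\varphi(N)$, $N\ge1$, is a sequence of positive real numbers satisfying $$\lim_{N\to\infty}\frac{\log N}{\varphi(N)}=0.$$ Then, for every real $x\ne0$, $$\lim_{N\to\infty}\mathbb{P}\left(\frac{H_N-\mathbb{E}(H_N)}{\varphi(N)}\le x\right)=\begin{cases}0, & x<0,\\ 1, & x>0.\end{cases}$$
   Context: For $\mu,\nu>0$ and an integer $N\ge1$, let $\{X_t:t\ge0\}$ be the continuous-time birth-and-death Markov chain on $E=\{0,1,\dots,N\}$ with conservative $Q$-matrix (row sums zero) whose off-diagonal entries are $q_{k,k+1}=(N-k)\nu$ for $0\le k\le N-1$, $q_{k,k-1}=k\mu$ for $1\le k\le N$, and $0$ otherwise. Its jump chain moves from $0$ to $1$ and from $N$ to $N-1$ with probability $1$, and for $1\le k\le N-1$ moves from $k$ to $k-1$ with probability $\frac{k}{k+(N-k)\rho}$ and from $k$ to $k+1$ with probability $\frac{(N-k)\rho}{k+(N-k)\rho}$, where $\rho=\nu/\mu$. Height: write $\{t:X_t>0\}=\bigcup_{i\ge1}[\tau_i,\eta_i)$ as the union of the maximal disjoint time intervals on which $X_t>0$, with $X_{\tau_i}=1$ and $X_{\eta_i}=0$, and set $H_N^{(i)}=\max\{X_t:t\in[\tau_i,\eta_i)\}$. The $H_N^{(i)}$ are independent and identically distributed, and $H_N$ denotes a random variable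 with their common distribution. Equivalently, $H_N$ is distributed as the maximal value reached by the chain started from $1$ before it first hits $0$; it takes values in $\{1,\dots,N\}$. Here $\log$ is the natural logarithm. *)

theory Defs
  imports "HOL-Probability.Probability"
begin

definition exit_rate :: "(nat \<Rightarrow> nat \<Rightarrow> real) \<Rightarrow> nat \<Rightarrow> real" where
  "exit_rate Q j = - Q j j"

definition jump_prob :: "(nat \<Rightarrow> nat \<Rightarrow> real) \<Rightarrow> nat \<Rightarrow> nat \<Rightarrow> real" where
  "jump_prob Q j k = (if j = k then 0 else Q j k / exit_rate Q j)"

text \<open>
  Continuous-time Markov chains on a finite state space \<open>E\<close> without absorbing states, with
  conservative \<open>Q\<close>-matrix \<open>Q\<close> and arbitrary initial distribution, given by the usual description
  through jump chain and holding times: \<open>Y\<close> is a discrete-time Markov chain with transition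
  matrix \<open>jump_prob Q\<close>, and given \<open>Y\<close> the holding times \<open>S 0, S 1, \<dots>\<close> in the states
  \<open>Y 0, Y 1, \<dots>\<close> are independent and exponential with parameters \<open>exit_rate Q (Y k)\<close>.
  The last conjunct says that \<open>X\<close> is the right-continuous step process built from \<open>Y\<close> and \<open>S\<close>.
  Divergence of the jump times (non-explosion) is automatic for finite \<open>E\<close>.
\<close>

definition jump_hold_law ::
  "'a measure \<Rightarrow> nat set \<Rightarrow> (nat \<Rightarrow> nat \<Rightarrow> real) \<Rightarrow> (nat \<Rightarrow> 'a \<Rightarrow> nat) \<Rightarrow> (nat \<Rightarrow> 'a \<Rightarrow> real) \<Rightarrow> bool"
  where
  "jump_hold_law M E Q Y S \<longleftrightarrow>
     (\<forall>n. Y n \<in> measurable M (count_space UNIV)) \<and>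
     (\<forall>n. S n \<in> borel_measurable M) \<and>
     (\<forall>n y s. (\<forall>k\<le>n. y k \<in> E) \<longrightarrow> (\<forall>k<n. 0 \<le> s k) \<longrightarrow>
        \<P>(\<omega> in M. (\<forall>k\<le>n. Y k \<omega> = y k) \<and> (\<forall>k<n. s k < S k \<omega>)) =
        \<P>(\<omega> in M. Y 0 \<omega> = y 0) *
          (\<Prod>k<n. jump_prob Q (y k) (y (Suc k)) * exp (- exit_rate Q (y k) * s k)))"

definition ctmc ::
  "'a measure \<Rightarrow> nat set \<Rightarrow> (nat \<Rightarrow> nat \<Rightarrow> real) \<Rightarrow> (real \<Rightarrow> 'a \<Rightarrow> nat) \<Rightarrow> bool"
  where
  "ctmc M E Q X \<longleftrightarrow>
     prob_space M \<and> finite E \<and>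
     (\<forall>j\<in>E. 0 < exit_rate Q j) \<and>
     (\<forall>j\<in>E. \<forall>k\<in>E. j \<noteq> k \<longrightarrow> 0 \<le> Q j k) \<and>
     (\<forall>j\<in>E. (\<Sum>k\<in>E. Q j k) = 0) \<and>
     (\<forall>t\<ge>0. X t \<in> measurable M (count_space UNIV)) \<and>
     (\<forall>t\<ge>0. \<forall>\<omega>\<in>space M. X t \<omega> \<in> E) \<and>
     (\<exists>Y S. jump_hold_law M E Q Y S \<and>
        (AE \<omega> in M.
           (\<forall>n. 0 < S n \<omega>) \<and>
           filterlim (\<lambda>n. \<Sum>k<n. S k \<omega>) at_top sequentially \<and>
           (\<forall>n t. (\<Sum>k<n. S k \<omega>) \<le> t \<and> t < (\<Sum>k<Suc n. S k \<omega>) \<longrightarrow> X t \<omega> = Y n \<omega>)))"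

definition bd_Q :: "real \<Rightarrow> real \<Rightarrow> nat \<Rightarrow> nat \<Rightarrow> nat \<Rightarrow> real" where
  "bd_Q \<mu> \<nu> N j k =
     (if k = Suc j then real (N - j) * \<nu>
      else if j = Suc k then real j * \<mu>
      else if j = k then - (real (N - j) * \<nu> + real j * \<mu>)
      else 0)"

lemma bd_Q_row_sum:
  assumes "j \<le> N"
  shows "(\<Sum>k\<in>{0..N}. bd_Q \<mu> \<nu> N j k) = 0"
proof -
  have "(\<Sum>k\<in>{0..N}. bd_Q \<mu> \<nu> N j k) =
    (\<Sum>k\<in>{0..N}. (if k = Suc j then real (N - j) * \<nu> else 0)
      + (if k = j - 1 then real j * \<mu> else 0)
      + (if k = j then - (real (N - j) * \<nu> + real j * \<mu>) else 0))"
    by (rule sum.cong) (auto simp: bd_Q_def)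
  also have "\<dots> = 0"
    using assms by (cases "j = N") (auto simp: sum.distrib)
  finally show ?thesis .
qed

lemma jump_prob_bd_Q:
  assumes "\<mu> > 0" "\<nu> > 0" "1 \<le> k" "k \<le> N - 1"
  shows "jump_prob (bd_Q \<mu> \<nu> N) k (k - 1) = real k / (real k + real (N - k) * (\<nu> / \<mu>))"
    and "jump_prob (bd_Q \<mu> \<nu> N) k (k + 1) =
           real (N - k) * (\<nu> / \<mu>) / (real k + real (N - k) * (\<nu> / \<mu>))"
proof -
  have pos: "0 < real (N - k) * \<nu> + real k * \<mu>" "0 < real k * \<mu> + real (N - k) * \<nu>"
    using assms by (auto intro: add_nonneg_pos add_pos_nonneg)
  have "real k + real (N - k) * (\<nu> / \<mu>) = (real (N - k) * \<nu> + real k * \<mu>) / \<mu>"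
    using assms by (simp add: field_simps)
  then show "jump_prob (bd_Q \<mu> \<nu> N) k (k - 1) = real k / (real k + real (N - k) * (\<nu> / \<mu>))"
    and "jump_prob (bd_Q \<mu> \<nu> N) k (k + 1) =
           real (N - k) * (\<nu> / \<mu>) / (real k + real (N - k) * (\<nu> / \<mu>))"
    using assms pos by (auto simp: jump_prob_def exit_rate_def bd_Q_def)
qed

lemma jump_prob_bd_Q_boundary:
  assumes "\<mu> > 0" "\<nu> > 0" "1 \<le> N"
  shows "jump_prob (bd_Q \<mu> \<nu> N) 0 1 = 1" and "jump_prob (bd_Q \<mu> \<nu> N) N (N - 1) = 1"
  using assms by (auto simp: jump_prob_def exit_rate_def bd_Q_def)

text \<open>
  The maximal intervals \<open>[\<tau>\<^sub>i, \<eta>\<^sub>i)\<close>, \<open>i \<ge> 1\<close>, on which a right-continuous step path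
  \<open>x : [0, \<infinity>) \<rightarrow> \<nat>\<close> is positive, enumerated in increasing order:
  \<open>\<tau>\<^sub>i = exc_start x i\<close> and \<open>\<eta>\<^sub>i = exc_end x i\<close>, with the convention \<open>\<eta>\<^sub>0 = 0\<close>.
\<close>

primrec exc_end :: "(real \<Rightarrow> nat) \<Rightarrow> nat \<Rightarrow> real" where
  "exc_end x 0 = 0"
| "exc_end x (Suc i) = Inf {t. Inf {s. exc_end x i \<le> s \<and> 0 < x s} \<le> t \<and> x t = 0}"

definition exc_start :: "(real \<Rightarrow> nat) \<Rightarrow> nat \<Rightarrow> real" where
  "exc_start x i = Inf {s. exc_end x (i - 1) \<le> s \<and> 0 < x s}"

definition exc_height :: "(real \<Rightarrow> nat) \<Rightarrow> nat \<Rightarrow> nat" where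
  "exc_height x i = Max (x ` {exc_start x i..<exc_end x i})"

text \<open>
  \<open>H\<close> is the height of the \<open>i\<close>-th excursion of a birth-and-death chain on \<open>{0..N}\<close>. The chain
  starts in \<open>{0, 1}\<close>, so that every excursion, including the first, starts in state 1. Taking
  \<open>X 0 = 1\<close> and \<open>i = 1\<close> gives the maximum of the chain started from 1 before it first hits 0.
\<close>

definition bd_height ::
  "real \<Rightarrow> real \<Rightarrow> nat \<Rightarrow> 'a measure \<Rightarrow> (real \<Rightarrow> 'a \<Rightarrow> nat) \<Rightarrow> nat \<Rightarrow> ('a \<Rightarrow> nat) \<Rightarrow> bool"
  where
  "bd_height \<mu> \<nu> N M X i H \<longleftrightarrow>
     ctmc M {0..N} (bd_Q \<mu> \<nu> N) X \<and>
     (AE \<omega> in M. X 0 \<omega> \<in> {0, 1}) \<and>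
     H \<in> measurable M (count_space UNIV) \<and>
     (AE \<omega> in M. H \<omega> = exc_height (\<lambda>t. X t \<omega>) i)"

end

theory Submission
  imports Defs "HOL-Real_Asymp.Real_Asymp"
begin

text \<open>
  With \<open>\<rho> = \<nu> / \<mu>\<close>, \<open>w\<^sub>j = 1 / (\<rho>\<^sup>j (N - 1 choose j))\<close> and \<open>S\<^sub>m = \<Sum>j<m. w\<^sub>j\<close>, the function \<open>S\<close> is
  harmonic for the jump chain off \<open>0\<close>, so an excursion reaches \<open>m\<close> with probability
  \<open>1 / S\<^sub>m\<close>. The \<open>w\<^sub>j\<close> are log-convex and \<open>\<Sum>j. 1 / w\<^sub>j = (1 + \<rho>)\<^sup>N\<^sup>-\<^sup>1\<close> makes them exponentially small
  in the middle; where they climb back to \<open>1\<close> (if at all), at an index \<open>c\<^sub>N\<close>, they grow geometrically with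
  ratio at least \<open>sqrt (1 + \<rho>)\<close>. Hence \<open>E \<bar>H\<^sub>N - c\<^sub>N\<bar>\<close> is bounded in \<open>N\<close>, and since
  \<open>\<phi> N \<rightarrow> \<infinity>\<close> the theorem follows from Markov's inequality.
\<close>

section \<open>The scale function\<close>

text \<open>The constant \<open>sqrt (1 + \<rho>)\<close>, called \<open>r\<close>, comes from
  splitting \<open>(1 + \<rho>) ^ (N - 1)\<close> into two equal factors \<open>r ^ (N - 1)\<close>.
  Some weight is at most \<open>N / r ^ (2 * (N - 1))\<close>, and growth from it by ratios at most
  \<open>r\<close> uses up at most one of the two factors, so the result is still at most
  \<open>N / r ^ (N - 1)\<close>. A weight can therefore climb back to 1 only where the ratio
  exceeds \<open>r\<close>, and by log-convexity it exceeds \<open>r\<close> from there on. Neither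
  the centre nor the mean has to be computed. The obstacle on the left is that the weights near 0
  are only polynomially small, about \<open>1 / N\<close> at index 1 and
  \<open>1 / N\<^sup>2\<close> at index 2, while the deviation below the centre is a double sum with
  up to \<open>N\<^sup>2\<close> terms. Index 1 occurs only once for each level and is treated
  apart. On the probabilistic side the model provides probabilities of finite paths only. A
  martingale that follows the whole path, including the time before excursion \<open>i\<close>
  begins, takes the place of the strong Markov property and gives the same law for every
  \<open>i\<close>.\<close>

definition bd_weight :: "real \<Rightarrow> nat \<Rightarrow> nat \<Rightarrow> real" where
  "bd_weight \<rho> N j = 1 / (\<rho> ^ j * real ((N - 1) choose j))"

definition bd_scale :: "real \<Rightarrow> nat \<Rightarrow> nat \<Rightarrow> real" where
  "bd_scale \<rho> N m = (\<Sum>j<m. bd_weight \<rho> N j)"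

text \<open>The quotient of consecutive weights. At \<open>Suc j = N\<close> the denominator
  vanishes and division by zero yields 0, which would break monotonicity; hence the side conditions
  \<open>Suc j < N\<close> below.\<close>

definition bd_ratio :: "real \<Rightarrow> nat \<Rightarrow> nat \<Rightarrow> real" where
  "bd_ratio \<rho> N j = real (Suc j) / (real (N - Suc j) * \<rho>)"

lemma bd_weight_0 [simp]: "bd_weight \<rho> N 0 = 1"
  by (simp add: bd_weight_def)

lemma bd_weight_nonneg: "\<rho> > 0 \<Longrightarrow> 0 \<le> bd_weight \<rho> N j"
  by (simp add: bd_weight_def)

text \<open>The origin of the weights: increments of a harmonic function must satisfy
  \<open>(N - k) * \<rho> * w k = k * w (k - 1)\<close>, and multiplying these relations up from
  \<open>w 0 = 1\<close> produces the binomial coefficient of \<open>N - 1\<close>.\<close>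

lemma bd_weight_Suc:
  assumes "\<rho> > 0" "Suc j < N"
  shows "bd_weight \<rho> N (Suc j) = bd_weight \<rho> N j * bd_ratio \<rho> N j"
proof -
  obtain n where n: "N = Suc n" using assms by (cases N) auto
  have "Suc j * (n choose Suc j) = (n - j) * (n choose j)"
    by (metis binomial_absorb_comp binomial_absorption)
  then have "real (Suc j) * real (n choose Suc j) = real (n - j) * real (n choose j)"
    by (metis of_nat_mult)
  then have "real (n choose Suc j) = real (n - j) * real (n choose j) / real (Suc j)"
    by (simp add: eq_divide_eq mult.commute del: of_nat_Suc binomial_Suc_Suc)
  then show ?thesis
    using assms n by (simp add: bd_weight_def bd_ratio_def mult_ac del: of_nat_Suc binomial_Suc_Suc)
qed

lemma bd_ratio_mono:
  assumes "\<rho> > 0" "i \<le> j" "Suc j < N"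
  shows "bd_ratio \<rho> N i \<le> bd_ratio \<rho> N j"
  unfolding bd_ratio_def using assms by (intro frac_le mult_right_mono) auto

lemma bd_scale_Suc: "bd_scale \<rho> N (Suc m) = bd_scale \<rho> N m + bd_weight \<rho> N m"
  by (simp add: bd_scale_def)

lemma bd_scale_0 [simp]: "bd_scale \<rho> N 0 = 0" by (simp add: bd_scale_def)

lemma bd_scale_ge_1: "\<rho> > 0 \<Longrightarrow> 1 \<le> m \<Longrightarrow> 1 \<le> bd_scale \<rho> N m"
  unfolding bd_scale_def using member_le_sum[of 0 "{..<m}" "bd_weight \<rho> N"]
  by (auto simp: bd_weight_nonneg)

lemma bd_scale_mono: "\<rho> > 0 \<Longrightarrow> k \<le> m \<Longrightarrow> bd_scale \<rho> N k \<le> bd_scale \<rho> N m"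
  unfolding bd_scale_def by (intro sum_mono2) (auto simp: bd_weight_nonneg)

lemma bd_weight_le_scale: "\<rho> > 0 \<Longrightarrow> j < m \<Longrightarrow> bd_weight \<rho> N j \<le> bd_scale \<rho> N m"
  unfolding bd_scale_def by (intro member_le_sum) (auto simp: bd_weight_nonneg)

text \<open>Ratios increase, so a bound on the last ratio of the stretch bounds all of them. The
  premise is conditional because for \<open>i = j\<close> there is no ratio to bound.\<close>

lemma bd_weight_le_power:
  assumes \<rho>: "\<rho> > 0" and "0 < r" "i \<le> j" "j < N" and q: "i < j \<Longrightarrow> bd_ratio \<rho> N (j - 1) \<le> r"
  shows "bd_weight \<rho> N j \<le> r ^ (j - i) * bd_weight \<rho> N i"
  using assms(3,4) q
proof (induction j rule: dec_induct)
  case (step k)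
  have "bd_weight \<rho> N k \<le> r ^ (k - i) * bd_weight \<rho> N i"
  proof (rule step.IH)
    show "k < N" using step by simp
    show "bd_ratio \<rho> N (k - 1) \<le> r" if "i < k"
      using bd_ratio_mono[OF \<rho>, of "k - 1" k N] step that by simp
  qed
  moreover have "bd_ratio \<rho> N k \<le> r" using step by simp
  moreover have "0 \<le> bd_ratio \<rho> N k" using \<rho> by (simp add: bd_ratio_def)
  ultimately have "bd_weight \<rho> N k * bd_ratio \<rho> N k \<le> (r ^ (k - i) * bd_weight \<rho> N i) * r"
    using \<rho> \<open>0 < r\<close> by (intro mult_mono) (auto simp: bd_weight_nonneg)
  then show ?case using step \<rho> by (simp add: bd_weight_Suc Suc_diff_le mult_ac)
qed simp

text \<open>The dual bound: here the first ratio of the stretch controls all later ones.\<close>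

lemma bd_weight_ge_power:
  assumes \<rho>: "\<rho> > 0" and "0 < r" "i \<le> j" "j < N" and q: "i < j \<Longrightarrow> r \<le> bd_ratio \<rho> N i"
  shows "r ^ (j - i) * bd_weight \<rho> N i \<le> bd_weight \<rho> N j"
  using assms(3,4) q
proof (induction j rule: dec_induct)
  case (step k)
  have "r ^ (k - i) * bd_weight \<rho> N i \<le> bd_weight \<rho> N k"
    using step by simp
  moreover have "r \<le> bd_ratio \<rho> N k"
    using bd_ratio_mono[OF \<rho>, of i k N] step by simp
  ultimately have "(r ^ (k - i) * bd_weight \<rho> N i) * r \<le> bd_weight \<rho> N k * bd_ratio \<rho> N k"
    using \<rho> \<open>0 < r\<close> by (intro mult_mono) (auto simp: bd_weight_nonneg)
  then show ?case using step \<rho> by (simp add: bd_weight_Suc Suc_diff_le mult_ac)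
qed simp

text \<open>Log-convexity puts the maximum over an interval at an endpoint: if the step into
  \<open>j\<close> is an increase, the weights do not decrease from \<open>j\<close> to
  \<open>b\<close>; otherwise they do not increase from \<open>a\<close> to
  \<open>j\<close>.\<close>

lemma bd_weight_le_max:
  assumes \<rho>: "\<rho> > 0" and "a \<le> j" "j \<le> b" "b < N"
  shows "bd_weight \<rho> N j \<le> max (bd_weight \<rho> N a) (bd_weight \<rho> N b)"
proof (cases "a < j \<and> 1 < bd_ratio \<rho> N (j - 1)")
  case True
  then have "1 \<le> bd_ratio \<rho> N j" if "j < b"
    using bd_ratio_mono[OF \<rho>, of "j - 1" j N] assms that by simp
  then show ?thesis using bd_weight_ge_power[OF \<rho>, of 1 j b N] assms by auto
next
  case False
  then show ?thesis using bd_weight_le_power[OF \<rho>, of 1 a j N] assms by auto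
qed

text \<open>The reciprocals of the weights are the terms of the binomial expansion of
  \<open>(1 + \<rho>) ^ n\<close>.\<close>

lemma sum_inverse_bd_weight:
  "(\<Sum>k\<le>n. 1 / bd_weight \<rho> (Suc n) k) = (1 + \<rho>) ^ n"
  using binomial_ring[of \<rho> 1 n] by (simp add: bd_weight_def mult.commute add.commute)

text \<open>Pigeonhole: among \<open>n + 1\<close> reciprocals with sum
  \<open>(1 + \<rho>) ^ n\<close>, one is at least the average.\<close>

lemma ex_small_bd_weight:
  assumes \<rho>: "\<rho> > 0"
  shows "\<exists>k\<le>n. bd_weight \<rho> (Suc n) k \<le> real (Suc n) / (1 + \<rho>) ^ n"
proof (rule ccontr)
  assume "\<not> ?thesis"
  then have *: "real (Suc n) / (1 + \<rho>) ^ n < bd_weight \<rho> (Suc n) k" if "k \<le> n" for k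
    using that by force
  have "1 / bd_weight \<rho> (Suc n) k < (1 + \<rho>) ^ n / real (Suc n)" if "k \<le> n" for k
  proof -
    have "0 < real (Suc n) / (1 + \<rho>) ^ n" using \<rho> by simp
    from divide_strict_left_mono[OF *[OF that], of 1] this \<rho> *[OF that] show ?thesis
      by (simp add: mult_pos_pos)
  qed
  then have "(\<Sum>k\<le>n. 1 / bd_weight \<rho> (Suc n) k) < (\<Sum>k\<le>n. (1 + \<rho>) ^ n / real (Suc n))"
    by (intro sum_strict_mono) auto
  then show False by (simp add: sum_inverse_bd_weight)
qed

text \<open>Compare with the index \<open>k\<close> of a weight of size at most
  \<open>N / r ^ (2 * n)\<close>. If \<open>k\<close> lies to the left, at most \<open>n\<close>
  growth steps of ratio at most \<open>r\<close> lead to \<open>Suc j\<close>. If it lies to the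
  right, \<open>Suc j\<close> is between \<open>a\<close> and \<open>k\<close>, and the endpoint
  bound applies. The left end \<open>a\<close> is kept free because both 1 and 2 are needed
  later.\<close>

lemma bd_weight_le_of_ratio:
  assumes \<rho>: "\<rho> > 0" and j: "a \<le> Suc j" "Suc j < N"
    and q: "bd_ratio \<rho> N j \<le> sqrt (1 + \<rho>)"
  shows "bd_weight \<rho> N (Suc j) \<le> max (bd_weight \<rho> N a) (real N / sqrt (1 + \<rho>) ^ (N - 1))"
proof -
  define r where "r = sqrt (1 + \<rho>)"
  have r: "1 < r" "r * r = 1 + \<rho>" using \<rho> by (auto simp: r_def)
  obtain n where n: "N = Suc n" using j by (cases N) auto
  have split: "(1 + \<rho>) ^ n = r ^ n * r ^ n" by (simp add: r(2)[symmetric] power_mult_distrib)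
  obtain k where k: "k \<le> n" "bd_weight \<rho> N k \<le> real N / (r ^ n * r ^ n)"
    using ex_small_bd_weight[OF \<rho>, of n] n split by auto
  show ?thesis
  proof (cases "k \<le> Suc j")
    case True
    have "bd_weight \<rho> N (Suc j) \<le> r ^ (Suc j - k) * bd_weight \<rho> N k"
      using bd_weight_le_power[OF \<rho>, of r k "Suc j" N] q j r True by (simp add: r_def)
    also have "\<dots> \<le> r ^ n * (real N / (r ^ n * r ^ n))"
      using k r j n by (intro mult_mono power_increasing) (auto simp: bd_weight_nonneg \<rho>)
    also have "\<dots> = real N / r ^ n" using r by simp
    finally show ?thesis using n by (simp add: r_def)
  next
    case False
    have "bd_weight \<rho> N k \<le> real N / r ^ n"
    proof -
      have "real N / (r ^ n * r ^ n) \<le> real N / (1 * r ^ n)"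
        using r by (intro divide_left_mono mult_right_mono) (auto simp: one_le_power)
      then show ?thesis using k by simp
    qed
    moreover have "bd_weight \<rho> N (Suc j) \<le> max (bd_weight \<rho> N a) (bd_weight \<rho> N k)"
      using bd_weight_le_max[OF \<rho>, of a "Suc j" k N] False j k n by auto
    ultimately show ?thesis using n by (auto simp: r_def)
  qed
qed

section \<open>Geometric sums and the choice of the centre\<close>

lemma geometric_sum_le:
  fixes r :: real
  assumes "1 < r"
  shows "(\<Sum>i<k. (1 / r) ^ i) \<le> r / (r - 1)"
proof -
  have "(\<Sum>i<k. (1 / r) ^ i) \<le> (\<Sum>i. (1 / r) ^ i)"
    using assms by (intro sum_le_suminf summable_geometric) auto
  also have "\<dots> = 1 / (1 - 1 / r)"
    using assms by (intro suminf_geometric) auto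
  also have "\<dots> = r / (r - 1)" using assms by (simp add: field_simps)
  finally show ?thesis .
qed

lemma reversed_geometric_sum_le:
  fixes r :: real
  assumes "1 < r"
  shows "(\<Sum>i<k. (1 / r) ^ (k - 1 - i)) \<le> r / (r - 1)"
  using geometric_sum_le[OF assms, of k] sum.nat_diff_reindex[of "\<lambda>i. (1 / r) ^ i" k]
  by simp

text \<open>The left-hand side is the mean distance of the height from \<open>c\<close>, written
  with tail probabilities. On the right, \<open>r / (r - 1)\<close> pays for levels above
  \<open>c\<close>, its square for the final climb below \<open>c\<close>, and the other terms for
  index 1 and for the weights bounded by \<open>bd_weight \<rho> N 2 + \<epsilon>\<close>.\<close>

lemma bd_centre_exists:
  fixes \<rho> :: real and N :: nat
  defines "r \<equiv> sqrt (1 + \<rho>)"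
  defines "\<epsilon> \<equiv> real N / r ^ (N - 1)"
  assumes \<rho>: "\<rho> > 0" and N: "3 \<le> N" and w1: "bd_weight \<rho> N 1 < 1" and \<epsilon>: "\<epsilon> < 1"
  shows "\<exists>c\<le>N. (\<Sum>m\<in>{c<..N}. 1 / bd_scale \<rho> N m) + (\<Sum>m\<in>{1..c}. 1 - 1 / bd_scale \<rho> N m)
           \<le> r / (r - 1) + (r / (r - 1))\<^sup>2 + real N * bd_weight \<rho> N 1
              + (real N)\<^sup>2 * (bd_weight \<rho> N 2 + \<epsilon>)"
proof -
  have r: "1 < r" using \<rho> by (simp add: r_def)
  \<comment> \<open>The first return of the weights to 1, or \<open>N\<close> if there is none. The
    search starts at 1 since the weight at 0 is already 1.\<close>
  define c where "c = (LEAST j. 1 \<le> j \<and> (N \<le> j \<or> 1 \<le> bd_weight \<rho> N j))"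
  have c: "1 \<le> c" "N \<le> c \<or> 1 \<le> bd_weight \<rho> N c"
    using LeastI[of "\<lambda>j. 1 \<le> j \<and> (N \<le> j \<or> 1 \<le> bd_weight \<rho> N j)" N] N unfolding c_def by auto
  have cN: "c \<le> N" unfolding c_def using N by (intro Least_le) auto
  have less_c: "bd_weight \<rho> N j < 1" if "1 \<le> j" "j < c" for j
    using not_less_Least[of j "\<lambda>j. 1 \<le> j \<and> (N \<le> j \<or> 1 \<le> bd_weight \<rho> N j)"] that
    unfolding c_def by auto
  have \<epsilon>0: "0 \<le> \<epsilon>" using r by (simp add: \<epsilon>_def)
  let ?w = "bd_weight \<rho> N" and ?S = "bd_scale \<rho> N"
  have above: "1 / ?S m \<le> (1 / r) ^ (m - 1 - c)" if "m \<in> {c<..N}" for m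
  proof -
    have "c < N" using that by auto
    then have wc: "1 \<le> ?w c" using c by auto
    \<comment> \<open>A ratio of at most \<open>r\<close> on entering \<open>c\<close> would leave
      the weight below \<open>max (?w 1) \<epsilon>\<close>, hence below 1, against the choice of
      \<open>c\<close>.\<close>
    have "r \<le> bd_ratio \<rho> N (c - 1)"
    proof (rule ccontr)
      assume "\<not> ?thesis"
      then have "?w c \<le> max (?w 1) \<epsilon>"
        using bd_weight_le_of_ratio[OF \<rho>, of 1 "c - 1" N] c \<open>c < N\<close> by (simp add: r_def \<epsilon>_def)
      then show False using wc w1 \<epsilon> by simp
    qed
    then have q: "r \<le> bd_ratio \<rho> N c" if "c < m - 1"
      using bd_ratio_mono[OF \<rho>, of "c - 1" c N] \<open>m \<in> _\<close> that by fastforce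
    have "r ^ (m - 1 - c) \<le> r ^ (m - 1 - c) * ?w c" using wc r by simp
    also have "\<dots> \<le> ?w (m - 1)"
      using bd_weight_ge_power[OF \<rho>, of r c "m - 1" N] q r that by auto
    also have "\<dots> \<le> ?S m" using that by (intro bd_weight_le_scale \<rho>) auto
    finally have "r ^ (m - 1 - c) \<le> ?S m" .
    moreover have "0 < r ^ (m - 1 - c)" using r by simp
    ultimately have "1 / ?S m \<le> 1 / r ^ (m - 1 - c)" by (intro frac_le) auto
    then show ?thesis by (simp add: power_one_over)
  qed
  have "(\<Sum>m\<in>{c<..N}. 1 / ?S m) \<le> (\<Sum>m\<in>{c<..N}. (1 / r) ^ (m - 1 - c))"
    using above by (rule sum_mono)
  also have "\<dots> = (\<Sum>i<N - c. (1 / r) ^ i)"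
    by (rule sum.reindex_bij_witness[of _ "\<lambda>i. i + c + 1" "\<lambda>m. m - 1 - c"]) auto
  also have "\<dots> \<le> r / (r - 1)" using r by (rule geometric_sum_le)
  finally have up: "(\<Sum>m\<in>{c<..N}. 1 / ?S m) \<le> r / (r - 1)" .
  \<comment> \<open>Two regimes before \<open>c\<close>: while the ratio is at most \<open>r\<close>
    the weight is trapped by \<open>?w 2\<close> and \<open>\<epsilon>\<close>; afterwards growth is
    at least geometric, and running it backwards from \<open>?w (c - 1) \<le> 1\<close> gives decay
    in the distance to \<open>c\<close>.\<close>
  have w_le: "?w j \<le> ?w 2 + \<epsilon> + (1 / r) ^ (c - 1 - j)" if j: "2 \<le> j" "j < c" for j
  proof (cases "bd_ratio \<rho> N (j - 1) \<le> r")
    case True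
    have "?w j \<le> max (?w 2) \<epsilon>"
      using bd_weight_le_of_ratio[OF \<rho>, of 2 "j - 1" N] j cN True by (simp add: r_def \<epsilon>_def)
    then show ?thesis using \<epsilon>0 r bd_weight_nonneg[OF \<rho>, of N 2]
      by (smt (verit) zero_le_divide_1_iff zero_le_power)
  next
    case False
    then have "r \<le> bd_ratio \<rho> N j" if "j < c - 1"
      using bd_ratio_mono[OF \<rho>, of "j - 1" j N] that cN by fastforce
    then have "r ^ (c - 1 - j) * ?w j \<le> ?w (c - 1)"
      using bd_weight_ge_power[OF \<rho>, of r j "c - 1" N] r j cN by auto
    also have "\<dots> \<le> 1" using less_c[of "c - 1"] j by fastforce
    finally have "?w j \<le> (1 / r) ^ (c - 1 - j)"
      using r by (simp add: power_one_over field_simps)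
    then show ?thesis using \<epsilon>0 bd_weight_nonneg[OF \<rho>, of N 2] by simp
  qed
  have below: "1 - 1 / ?S m \<le> ?w 1 + real N * (?w 2 + \<epsilon>) + r / (r - 1) * (1 / r) ^ (c - m)"
    if m: "m \<in> {1..c}" for m
  proof -
    have S1: "1 \<le> ?S m" using m \<rho> by (intro bd_scale_ge_1) auto
    \<comment> \<open>Since \<open>?S m \<ge> 1\<close>, the probability of missing level
      \<open>m\<close> is at most \<open>?S m - 1\<close>, which is linear in the weights.\<close>
    then have "(?S m - 1) / ?S m \<le> (?S m - 1) / 1" by (intro divide_left_mono) auto
    then have "1 - 1 / ?S m \<le> ?S m - 1" using S1 by (simp add: diff_divide_distrib)
    also have "?S m - 1 = (\<Sum>j\<in>{1..<m}. ?w j)"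
      using m by (simp add: bd_scale_def lessThan_atLeast0 sum.atLeast_Suc_lessThan)
    also have "\<dots> \<le> (\<Sum>j\<in>{1..<m}. (if j = 1 then ?w 1 else 0) + (?w 2 + \<epsilon>) + (1 / r) ^ (c - 1 - j))"
    proof (rule sum_mono)
      fix j assume j: "j \<in> {1..<m}"
      show "?w j \<le> (if j = 1 then ?w 1 else 0) + (?w 2 + \<epsilon>) + (1 / r) ^ (c - 1 - j)"
      proof (cases "j = 1")
        case True
        then show ?thesis using \<epsilon>0 bd_weight_nonneg[OF \<rho>, of N 2] r by simp
      next
        case False
        then show ?thesis using w_le[of j] j m by auto
      qed
    qed
    also have "\<dots> \<le> ?w 1 + real N * (?w 2 + \<epsilon>) + (\<Sum>j<m. (1 / r) ^ (c - 1 - j))"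
    proof -
      have "(\<Sum>j\<in>{1..<m}. if j = 1 then ?w 1 else 0) \<le> ?w 1"
        using bd_weight_nonneg[OF \<rho>, of N 1] by simp
      moreover have "real (m - 1) * (?w 2 + \<epsilon>) \<le> real N * (?w 2 + \<epsilon>)"
        using m cN \<epsilon>0 bd_weight_nonneg[OF \<rho>, of N 2] by (intro mult_right_mono) auto
      moreover have "(\<Sum>j\<in>{1..<m}. (1 / r) ^ (c - 1 - j)) \<le> (\<Sum>j<m. (1 / r) ^ (c - 1 - j))"
        using r by (intro sum_mono2) auto
      ultimately show ?thesis by (simp add: sum.distrib)
    qed
    \<comment> \<open>Extracting the distance from \<open>m\<close> to \<open>c\<close> leaves a
      factor that is summable once more, now over \<open>m\<close>.\<close>
    also have "(\<Sum>j<m. (1 / r) ^ (c - 1 - j)) = (1 / r) ^ (c - m) * (\<Sum>j<m. (1 / r) ^ (m - 1 - j))"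
      unfolding sum_distrib_left power_add[symmetric]
      using m by (intro sum.cong) (auto intro!: arg_cong[of _ _ "\<lambda>k. _ ^ k"])
    also have "\<dots> \<le> (1 / r) ^ (c - m) * (r / (r - 1))"
      using r by (intro mult_left_mono reversed_geometric_sum_le) auto
    finally show ?thesis by (simp add: mult.commute)
  qed
  have "(\<Sum>m\<in>{1..c}. 1 - 1 / ?S m)
      \<le> (\<Sum>m\<in>{1..c}. ?w 1 + real N * (?w 2 + \<epsilon>) + r / (r - 1) * (1 / r) ^ (c - m))"
    using below by (rule sum_mono)
  also have "\<dots> = real c * (?w 1 + real N * (?w 2 + \<epsilon>)) + r / (r - 1) * (\<Sum>m\<in>{1..c}. (1 / r) ^ (c - m))"
    by (simp add: sum.distrib sum_distrib_left distrib_left)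
  also have "(\<Sum>m\<in>{1..c}. (1 / r) ^ (c - m)) = (\<Sum>i<c. (1 / r) ^ i)"
    by (rule sum.reindex_bij_witness[of _ "\<lambda>i. c - i" "\<lambda>m. c - m"]) auto
  also have "real c * (?w 1 + real N * (?w 2 + \<epsilon>)) + r / (r - 1) * (\<Sum>i<c. (1 / r) ^ i)
     \<le> real N * (?w 1 + real N * (?w 2 + \<epsilon>)) + r / (r - 1) * (r / (r - 1))"
    using r cN \<epsilon>0 bd_weight_nonneg[OF \<rho>, of N 2] bd_weight_nonneg[OF \<rho>, of N 1]
    by (intro add_mono mult_mono geometric_sum_le sum_nonneg) auto
  finally show ?thesis using up cN
    by (intro exI[of _ c]) (simp add: algebra_simps power2_eq_square)
qed

lemma bd_centre_bounded:
  fixes \<rho> :: real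
  assumes \<rho>: "\<rho> > 0"
  shows "\<exists>C>0. \<forall>\<^sub>F N in sequentially. \<exists>c\<le>N.
    (\<Sum>m\<in>{c<..N}. 1 / bd_scale \<rho> N m) + (\<Sum>m\<in>{1..c}. 1 - 1 / bd_scale \<rho> N m) \<le> C"
proof -
  define r where "r = sqrt (1 + \<rho>)"
  have r: "1 < r" using \<rho> by (simp add: r_def)
  have w1: "bd_weight \<rho> N 1 = 1 / (\<rho> * (real N - 1))" if "3 \<le> N" for N
    using that by (simp add: bd_weight_def)
  have w2: "bd_weight \<rho> N 2 = 2 / (\<rho>\<^sup>2 * ((real N - 1) * (real N - 2)))" if "3 \<le> N" for N
  proof -
    have "real ((N - 1) choose 2) = (real N - 1) * (real N - 2) / 2"
      using that by (simp add: choose_two real_of_nat_div of_nat_diff)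
    then show ?thesis by (simp only: bd_weight_def) simp
  qed
  have l1: "((\<lambda>N. 1 / (\<rho> * (real N - 1))) \<longlongrightarrow> 0) sequentially" using \<rho> by real_asymp
  have l2: "((\<lambda>N. real N * (1 / (\<rho> * (real N - 1)))) \<longlongrightarrow> 1 / \<rho>) sequentially"
    using \<rho> by (real_asymp simp: field_simps)
  have l3: "((\<lambda>N. real N ^ 2 * (2 / (\<rho>\<^sup>2 * ((real N - 1) * (real N - 2))))) \<longlongrightarrow> 2 / \<rho>^2) sequentially"
    using \<rho> by (real_asymp simp: field_simps)
  have l4: "((\<lambda>N. real N ^ 2 * (real N / r ^ (N - 1))) \<longlongrightarrow> 0) sequentially"
    using r by real_asymp
  have l5: "((\<lambda>N. real N / r ^ (N - 1)) \<longlongrightarrow> 0) sequentially"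
    using r by real_asymp
  \<comment> \<open>Each of the limits \<open>1 / \<rho>\<close>, \<open>2 / \<rho>\<^sup>2\<close>
    and 0 receives a slack of 1, so that the bound holds eventually.\<close>
  let ?C = "r / (r - 1) + (r / (r - 1))\<^sup>2 + (1 / \<rho> + 1) + (2 / \<rho>^2 + 1) + 1"
  have "\<forall>\<^sub>F N in sequentially. \<exists>c\<le>N.
    (\<Sum>m\<in>{c<..N}. 1 / bd_scale \<rho> N m) + (\<Sum>m\<in>{1..c}. 1 - 1 / bd_scale \<rho> N m) \<le> ?C"
    using order_tendstoD(2)[OF l1 zero_less_one] order_tendstoD(2)[OF l2 less_add_one]
      order_tendstoD(2)[OF l3 less_add_one] order_tendstoD(2)[OF l4 zero_less_one]
      order_tendstoD(2)[OF l5 zero_less_one] eventually_ge_at_top[of 3]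
  proof eventually_elim
    case (elim N)
    have "bd_weight \<rho> N 1 < 1" using elim w1 by simp
    from bd_centre_exists[OF \<rho> _ this] elim obtain c where "c \<le> N"
      "(\<Sum>m\<in>{c<..N}. 1 / bd_scale \<rho> N m) + (\<Sum>m\<in>{1..c}. 1 - 1 / bd_scale \<rho> N m)
           \<le> r / (r - 1) + (r / (r - 1))\<^sup>2 + real N * bd_weight \<rho> N 1
              + (real N)\<^sup>2 * (bd_weight \<rho> N 2 + real N / r ^ (N - 1))"
      by (auto simp: r_def)
    then show ?case using elim
      by (intro exI[of _ c]) (simp add: w1[unfolded One_nat_def] w2 distrib_left)
  qed
  moreover have "?C > 0" using r \<rho> by (simp add: add_pos_pos)
  ultimately show ?thesis by blast
qed

section \<open>Excursions of step paths\<close>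

text \<open>The index of the latest excursion begun so far. It is not reset on the zeros that
  follow, so excursion \<open>i\<close> consists of the \<open>j\<close> with
  \<open>exc_count y j = i\<close> and \<open>0 < y j\<close>. A positive start counts at once, in
  accordance with \<open>exc_end x 0 = 0\<close>.\<close>

fun exc_count :: "(nat \<Rightarrow> nat) \<Rightarrow> nat \<Rightarrow> nat" where
  "exc_count y 0 = (if 0 < y 0 then 1 else 0)"
| "exc_count y (Suc n) = exc_count y n + (if y n = 0 \<and> 0 < y (Suc n) then 1 else 0)"

lemma exc_count_mono: "m \<le> n \<Longrightarrow> exc_count y m \<le> exc_count y n"
  by (induction n rule: dec_induct) auto

lemma exc_count_cong:
  "(\<And>k. k \<le> n \<Longrightarrow> y k = y' k) \<Longrightarrow> exc_count y n = exc_count y' n"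
  by (induction n) auto

text \<open>Between a zero and a later positive state there is a step up from 0; this separates
  successive excursions.\<close>

lemma exc_count_less:
  assumes "y a = 0" "0 < y j" "a \<le> j"
  shows "exc_count y a < exc_count y j"
  using assms(3,2)
proof (induction j rule: dec_induct)
  case (step k)
  show ?case
  proof (cases "y k = 0")
    case True
    then show ?thesis using step exc_count_mono[of a k y] by simp
  next
    case False
    then show ?thesis using step by simp
  qed
qed (use assms in simp)

lemma exc_count_const_pos:
  assumes "a \<le> j" "\<And>k. a \<le> k \<Longrightarrow> k < j \<Longrightarrow> 0 < y k"
  shows "exc_count y j = exc_count y a"
  using assms by (induction j rule: dec_induct) auto

lemma exc_count_const_zero:
  assumes "a \<le> j" "\<And>k. a < k \<Longrightarrow> k \<le> j \<Longrightarrow> y k = 0"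
  shows "exc_count y j = exc_count y a"
  using assms by (induction j rule: dec_induct) auto

lemma exc_count_unbounded:
  assumes z: "\<And>a. \<exists>n\<ge>a. y n = 0" and p: "\<And>a. \<exists>n\<ge>a. 0 < y n"
  shows "\<exists>n. i \<le> exc_count y n"
proof (induction i)
  case (Suc i)
  then obtain n where n: "i \<le> exc_count y n" by auto
  obtain a where a: "n \<le> a" "y a = 0" using z by auto
  obtain b where b: "a \<le> b" "0 < y b" using p by auto
  have "i < exc_count y b"
    using exc_count_less[of y a b] exc_count_mono[of n a y] a b n by simp
  then show ?case by (auto intro: exI[of _ b])
qed simp

locale step_path =
  fixes x :: "real \<Rightarrow> nat" and y :: "nat \<Rightarrow> nat" and T :: "nat \<Rightarrow> real"
  assumes T_0: "T 0 = 0" and T_strict: "\<And>n. T n < T (Suc n)"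
    and T_top: "filterlim T at_top sequentially"
    and x_eq: "\<And>n t. T n \<le> t \<Longrightarrow> t < T (Suc n) \<Longrightarrow> x t = y n"
begin

lemma T_strict_mono: "strict_mono T"
  using T_strict by (rule strict_monoI_Suc)

lemma T_le_iff [simp]: "T m \<le> T n \<longleftrightarrow> m \<le> n"
  using T_strict_mono by (rule strict_mono_less_eq)

lemma T_less_iff [simp]: "T m < T n \<longleftrightarrow> m < n"
  using T_strict_mono by (rule strict_mono_less)

lemma x_T [simp]: "x (T n) = y n"
  by (rule x_eq) auto

lemma index_exists:
  assumes "0 \<le> t"
  shows "\<exists>n. T n \<le> t \<and> t < T (Suc n)"
proof -
  obtain m where "t < T m"
    using eventually_happens[OF filterlim_at_top_dense[THEN iffD1, OF T_top, rule_format, of t]] by auto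
  then have *: "t < T (LEAST m. t < T m)" by (rule LeastI)
  then obtain n where n: "(LEAST m. t < T m) = Suc n"
    using assms T_0 by (cases "LEAST m. t < T m") auto
  have "\<not> t < T n" using not_less_Least[of n "\<lambda>m. t < T m"] n by auto
  then show ?thesis using * n by (intro exI[of _ n]) auto
qed

text \<open>The path is constant on each interval from \<open>T n\<close> to
  \<open>T (Suc n)\<close>, so the infimum is attained, and at a jump time. This turns the
  continuous-time hitting times into discrete ones.\<close>

lemma Inf_hitting:
  assumes "\<exists>n\<ge>a. Q (y n)"
  defines "b \<equiv> LEAST n. a \<le> n \<and> Q (y n)"
  shows "Inf {t. T a \<le> t \<and> Q (x t)} = T b"
proof (rule cInf_eq_minimum)
  have b: "a \<le> b \<and> Q (y b)" unfolding b_def using LeastI_ex[OF assms(1)] by simp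
  then show "T b \<in> {t. T a \<le> t \<and> Q (x t)}" by simp
  fix t assume t: "t \<in> {t. T a \<le> t \<and> Q (x t)}"
  have "0 \<le> T a" using T_le_iff[of 0 a] T_0 by simp
  then obtain n where n: "T n \<le> t" "t < T (Suc n)" using index_exists[of t] t by auto
  have "a \<le> n" using t n T_less_iff[of a "Suc n"] le_less_trans[of "T a" t "T (Suc n)"] by simp
  moreover have "Q (y n)" using t n x_eq by auto
  ultimately have "b \<le> n" unfolding b_def by (intro Least_le) auto
  then show "T b \<le> t" using n T_le_iff[of b n] by linarith
qed

lemma image_Ico: "x ` {T a..<T b} = y ` {a..<b}"
proof (intro equalityI image_subsetI)
  fix t assume t: "t \<in> {T a..<T b}"
  have "0 \<le> T a" using T_le_iff[of 0 a] T_0 by simp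
  then obtain n where n: "T n \<le> t" "t < T (Suc n)" using index_exists[of t] t by auto
  have "T a < T (Suc n)" "T n < T b" using t n le_less_trans[of "T a" t "T (Suc n)"] le_less_trans[of "T n" t "T b"] by auto
  then have "a \<le> n" "n < b" by auto
  then show "x t \<in> y ` {a..<b}" using x_eq n by auto
next
  fix n assume "n \<in> {a..<b}"
  then show "y n \<in> x ` {T a..<T b}" by (intro image_eqI[of _ _ "T n"]) auto
qed

lemma exc_height_eq:
  assumes z: "\<And>a. \<exists>n\<ge>a. y n = 0" and p: "\<And>a. \<exists>n\<ge>a. 0 < y n"
  shows "\<exists>a b. a < b \<and> exc_height x (Suc i) = Max (y ` {a..<b}) \<and>
     exc_end x (Suc i) = T b \<and> y b = 0 \<and> exc_count y b = Suc i \<and>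
     {a..<b} = {j. exc_count y j = Suc i \<and> 0 < y j}"
proof -
  \<comment> \<open>The search for excursion \<open>Suc i\<close> starts at jump index
    \<open>e\<close>. The two alternatives in \<open>e0\<close> are needed because at time 0 the
    path may already be positive, whereas every later search starts at a zero.\<close>
  have step: "\<exists>a b. a < b \<and> exc_height x (Suc i) = Max (y ` {a..<b}) \<and>
     exc_end x (Suc i) = T b \<and> y b = 0 \<and> exc_count y b = Suc i \<and>
     {a..<b} = {j. exc_count y j = Suc i \<and> 0 < y j}"
    if e: "exc_end x i = T e" and e0: "e = 0 \<and> i = 0 \<or> y e = 0 \<and> exc_count y e = i" for e i
  proof -
    define a where "a = (LEAST n. e \<le> n \<and> 0 < y n)"
    define b where "b = (LEAST n. a \<le> n \<and> y n = 0)"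
    have a: "e \<le> a \<and> 0 < y a" unfolding a_def using LeastI_ex[OF p[of e]] by simp
    have b: "a \<le> b \<and> y b = 0" unfolding b_def using LeastI_ex[OF z[of a]] by simp
    have ab: "a < b" using a b by (metis le_neq_implies_less less_irrefl)
    have Ta: "Inf {s. exc_end x i \<le> s \<and> 0 < x s} = T a"
      using Inf_hitting[of e "\<lambda>k. 0 < k"] p[of e] by (simp add: a_def e)
    have Tb: "exc_end x (Suc i) = T b"
      using Inf_hitting[of a "\<lambda>k. k = 0"] z[of a] by (simp add: b_def Ta)
    have start: "exc_start x (Suc i) = T a" by (simp add: exc_start_def Ta)
    have before_a: "y k = 0" if "e \<le> k" "k < a" for k
      using not_less_Least[of k "\<lambda>n. e \<le> n \<and> 0 < y n"] that by (auto simp: a_def)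
    have before_b: "0 < y k" if "a \<le> k" "k < b" for k
      using not_less_Least[of k "\<lambda>n. a \<le> n \<and> y n = 0"] that by (auto simp: b_def)
    have pred: "exc_count y (a - 1) = i \<and> y (a - 1) = 0" if "0 < a"
    proof (cases "e = a")
      case True
      then show ?thesis using e0 a that by auto
    next
      case False
      then have "e \<le> a - 1" using a by auto
      then have "exc_count y (a - 1) = exc_count y e"
        using that by (intro exc_count_const_zero before_a) auto
      moreover have "y e = 0" "y (a - 1) = 0" using before_a[of e] before_a[of "a - 1"] a False that by auto
      ultimately show ?thesis using e0 by auto
    qed
    have cnt_a: "exc_count y a = Suc i"
    proof (cases a)
      case 0
      then show ?thesis using a e0 by auto
    next
      case (Suc k)
      then show ?thesis using pred a by simp
    qed
    have cnt: "exc_count y j = Suc i" if "a \<le> j" "j \<le> b" for j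
      using exc_count_const_pos[OF \<open>a \<le> j\<close>, of y] before_b that cnt_a by auto
    have "{a..<b} = {j. exc_count y j = Suc i \<and> 0 < y j}"
    proof safe
      fix j assume j: "exc_count y j = Suc i" "0 < y j"
      have "a \<le> j"
      proof (rule ccontr)
        assume "\<not> a \<le> j"
        then have "j \<le> a - 1" "0 < a" by auto
        then show False using pred exc_count_mono[of j "a - 1" y] j by auto
      qed
      moreover have "j < b"
      proof (rule ccontr)
        assume "\<not> j < b"
        then show False using exc_count_less[of y b j] b j cnt[of b] ab by auto
      qed
      ultimately show "j \<in> {a..<b}" by auto
    qed (use cnt before_b in auto)
    moreover have "exc_height x (Suc i) = Max (y ` {a..<b})"
      by (simp add: exc_height_def start Tb image_Ico del: exc_end.simps)
    ultimately show ?thesis using ab Tb b cnt[of b] by (intro exI[of _ a] exI[of _ b]) simp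
  qed
  show ?thesis
  proof (induction i)
    case 0
    show ?case using step[of 0 0] T_0 by simp
  next
    case (Suc i)
    then show ?case using step[of "Suc i"] by blast
  qed
qed

text \<open>Expresses the height through conditions that each involve only finitely many jumps.
  \<open>1 \<le> m\<close> excludes the zeros after the excursion, where \<open>exc_count\<close> is
  still \<open>i\<close>.\<close>

lemma exc_height_ge_iff:
  assumes z: "\<And>a. \<exists>n\<ge>a. y n = 0" and p: "\<And>a. \<exists>n\<ge>a. 0 < y n" and "1 \<le> i" "1 \<le> m"
  shows "m \<le> exc_height x i \<longleftrightarrow> (\<exists>j. exc_count y j = i \<and> m \<le> y j)"
proof -
  obtain i' where i: "i = Suc i'" using assms(3) by (cases i) auto
  obtain a b where ab: "a < b" "exc_height x i = Max (y ` {a..<b})"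
    "{a..<b} = {j. exc_count y j = i \<and> 0 < y j}"
    using exc_height_eq[OF z p, of i'] i by blast
  have "m \<le> exc_height x i \<longleftrightarrow> (\<exists>j\<in>{a..<b}. m \<le> y j)"
    using ab(1,2) by (simp add: Max_ge_iff)
  also have "\<dots> \<longleftrightarrow> (\<exists>j. exc_count y j = i \<and> m \<le> y j)"
    unfolding ab(3) using assms(4) by auto
  finally show ?thesis .
qed

end

section \<open>Hitting probabilities of the jump chain\<close>

lemma (in finite_measure) measure_eq_integral_of_bool:
  assumes "{\<omega>\<in>space M. P \<omega>} \<in> sets M"
  shows "measure M {\<omega>\<in>space M. P \<omega>} = (\<integral>\<omega>. of_bool (P \<omega>) \<partial>M)"
proof -
  have "(\<integral>\<omega>. of_bool (P \<omega>) \<partial>M) = (\<integral>\<omega>. indicator {\<omega>\<in>space M. P \<omega>} \<omega> \<partial>M)"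
    by (intro Bochner_Integration.integral_cong) (auto simp: indicator_def)
  also have "\<dots> = measure M {\<omega>\<in>space M. P \<omega>}"
    by (rule has_bochner_integral_integral_eq[OF has_bochner_integral_real_indicator[OF assms]])
      (simp add: emeasure_eq_measure)
  finally show ?thesis by simp
qed

text \<open>The Markov property is stated through path probabilities, without conditioning.
  Membership in \<open>E\<close> holds everywhere, not just almost surely, so that the decomposition
  over finite paths is a pointwise identity.\<close>

locale finite_jump_chain = prob_space M for M :: "'a measure" +
  fixes E :: "nat set" and p :: "nat \<Rightarrow> nat \<Rightarrow> real" and Y :: "nat \<Rightarrow> 'a \<Rightarrow> nat"
  assumes finite_E: "finite E"
    and Y_measurable [measurable]: "\<And>n. Y n \<in> measurable M (count_space UNIV)"
    and Y_in_E: "\<And>n \<omega>. \<omega> \<in> space M \<Longrightarrow> Y n \<omega> \<in> E"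
    and law_Suc: "\<And>n y. (\<And>k. k \<le> Suc n \<Longrightarrow> y k \<in> E) \<Longrightarrow>
       \<P>(\<omega> in M. \<forall>k\<le>Suc n. Y k \<omega> = y k) = \<P>(\<omega> in M. \<forall>k\<le>n. Y k \<omega> = y k) * p (y n) (y (Suc n))"
begin

section \<open>Functionals of finitely many states\<close>

abbreviation path :: "'a \<Rightarrow> nat \<Rightarrow> nat" where "path \<omega> \<equiv> \<lambda>k. Y k \<omega>"

text \<open>With finite \<open>E\<close> there are finitely many prefixes, so such a functional is a
  finite combination of cylinder indicators; measurability, integrability and the expectation all
  follow from this.\<close>

lemma prefix_decomp:
  fixes F :: "(nat \<Rightarrow> nat) \<Rightarrow> real"
  assumes dep: "\<And>y y'. (\<And>k. k \<le> n \<Longrightarrow> y k = y' k) \<Longrightarrow> F y = F y'" and \<omega>: "\<omega> \<in> space M"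
  shows "F (path \<omega>) = (\<Sum>y\<in>{..n} \<rightarrow>\<^sub>E E. F y * indicator {\<omega>\<in>space M. \<forall>k\<le>n. Y k \<omega> = y k} \<omega>)"
proof -
  let ?y = "restrict (path \<omega>) {..n}"
  have fin: "finite ({..n} \<rightarrow>\<^sub>E E)" using finite_E by (intro finite_PiE) auto
  have mem: "?y \<in> {..n} \<rightarrow>\<^sub>E E" using Y_in_E[OF \<omega>] by auto
  have iff: "(\<forall>k\<le>n. Y k \<omega> = y k) \<longleftrightarrow> y = ?y" if "y \<in> {..n} \<rightarrow>\<^sub>E E" for y
    using that by (auto simp: fun_eq_iff restrict_def PiE_def extensional_def)
  have "(\<Sum>y\<in>{..n} \<rightarrow>\<^sub>E E. F y * indicator {\<omega>\<in>space M. \<forall>k\<le>n. Y k \<omega> = y k} \<omega>)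
      = (\<Sum>y\<in>{..n} \<rightarrow>\<^sub>E E. if y = ?y then F y else 0)"
    using \<omega> iff by (intro sum.cong) (auto simp: indicator_def)
  also have "\<dots> = F ?y" using fin mem by simp
  also have "\<dots> = F (path \<omega>)" by (rule dep) auto
  finally show ?thesis by simp
qed

lemma prefix_measurable:
  fixes F :: "(nat \<Rightarrow> nat) \<Rightarrow> real"
  assumes dep: "\<And>y y'. (\<And>k. k \<le> n \<Longrightarrow> y k = y' k) \<Longrightarrow> F y = F y'"
  shows "(\<lambda>\<omega>. F (path \<omega>)) \<in> borel_measurable M"
proof (subst measurable_cong)
  show "F (path \<omega>) = (\<Sum>y\<in>{..n} \<rightarrow>\<^sub>E E. F y * indicator {\<omega>\<in>space M. \<forall>k\<le>n. Y k \<omega> = y k} \<omega>)"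
    if "\<omega> \<in> space M" for \<omega>
    by (rule prefix_decomp[OF dep that])
qed measurable

lemma prefix_has_bochner_integral:
  fixes F :: "(nat \<Rightarrow> nat) \<Rightarrow> real"
  assumes dep: "\<And>y y'. (\<And>k. k \<le> n \<Longrightarrow> y k = y' k) \<Longrightarrow> F y = F y'"
  shows "has_bochner_integral M (\<lambda>\<omega>. F (path \<omega>))
           (\<Sum>y\<in>{..n} \<rightarrow>\<^sub>E E. F y * \<P>(\<omega> in M. \<forall>k\<le>n. Y k \<omega> = y k))"
proof (subst has_bochner_integral_cong)
  show "F (path \<omega>) = (\<Sum>y\<in>{..n} \<rightarrow>\<^sub>E E. F y * indicator {\<omega>\<in>space M. \<forall>k\<le>n. Y k \<omega> = y k} \<omega>)"
    if "\<omega> \<in> space M" for \<omega>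
    by (rule prefix_decomp[OF dep that])
  show "has_bochner_integral M
     (\<lambda>\<omega>. \<Sum>y\<in>{..n} \<rightarrow>\<^sub>E E. F y * indicator {\<omega>\<in>space M. \<forall>k\<le>n. Y k \<omega> = y k} \<omega>)
     (\<Sum>y\<in>{..n} \<rightarrow>\<^sub>E E. F y * \<P>(\<omega> in M. \<forall>k\<le>n. Y k \<omega> = y k))"
    by (intro has_bochner_integral_sum has_bochner_integral_mult_right
        has_bochner_integral_real_indicator) (auto simp: emeasure_eq_measure)
qed (rule refl)+

lemmas prefix_integrable = integrable.intros[OF prefix_has_bochner_integral]

lemma prefix_sets:
  assumes "\<And>y y'. (\<And>k. k \<le> n \<Longrightarrow> y k = y' k) \<Longrightarrow> P y = P y'"
  shows "{\<omega>\<in>space M. P (path \<omega>)} \<in> sets M"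
proof -
  have "of_bool (P y) = (of_bool (P y') :: real)" if "\<And>k. k \<le> n \<Longrightarrow> y k = y' k" for y y'
    using assms[OF that] by simp
  then have "(\<lambda>\<omega>. of_bool (P (path \<omega>)) :: real) \<in> borel_measurable M"
    by (rule prefix_measurable[where n = n])
  from measurable_sets[OF this, of "{1}"] show ?thesis
    by (simp add: vimage_def Int_def conj_commute)
qed

text \<open>The Markov property in integrated form, used instead of conditional expectations:
  \<open>G\<close> is \<open>F\<close> with the state at time \<open>Suc n\<close> turned into a
  free argument, which is then averaged with the transition probabilities.\<close>

lemma expectation_step:
  fixes F :: "(nat \<Rightarrow> nat) \<Rightarrow> real" and G :: "(nat \<Rightarrow> nat) \<Rightarrow> nat \<Rightarrow> real"
  assumes dep: "\<And>y y' z. (\<And>k. k \<le> n \<Longrightarrow> y k = y' k) \<Longrightarrow> G y z = G y' z"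
    and F: "\<And>y. F y = G y (y (Suc n))"
  shows "expectation (\<lambda>\<omega>. F (path \<omega>)) = expectation (\<lambda>\<omega>. \<Sum>z\<in>E. p (Y n \<omega>) z * G (path \<omega>) z)"
proof -
  let ?A = "\<lambda>y z. {\<omega>\<in>space M. (\<forall>k\<le>n. Y k \<omega> = y k) \<and> Y (Suc n) \<omega> = z}"
  have F_eq: "F (path \<omega>) = (\<Sum>y\<in>{..n} \<rightarrow>\<^sub>E E. \<Sum>z\<in>E. G y z * indicator (?A y z) \<omega>)"
    if \<omega>: "\<omega> \<in> space M" for \<omega>
  proof -
    have "F (path \<omega>) = (\<Sum>y\<in>{..n} \<rightarrow>\<^sub>E E. G y (Y (Suc n) \<omega>) * indicator {\<omega>\<in>space M. \<forall>k\<le>n. Y k \<omega> = y k} \<omega>)"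
      unfolding F by (rule prefix_decomp[where F = "\<lambda>y. G y (Y (Suc n) \<omega>)", OF dep \<omega>])
    also have "\<dots> = (\<Sum>y\<in>{..n} \<rightarrow>\<^sub>E E. \<Sum>z\<in>E. if z = Y (Suc n) \<omega> then G y z * indicator {\<omega>\<in>space M. \<forall>k\<le>n. Y k \<omega> = y k} \<omega> else 0)"
      using Y_in_E[OF \<omega>, of "Suc n"] finite_E by simp
    also have "\<dots> = (\<Sum>y\<in>{..n} \<rightarrow>\<^sub>E E. \<Sum>z\<in>E. G y z * indicator (?A y z) \<omega>)"
      by (intro sum.cong) (auto simp: indicator_def)
    finally show ?thesis .
  qed
  have "has_bochner_integral M (\<lambda>\<omega>. \<Sum>y\<in>{..n} \<rightarrow>\<^sub>E E. \<Sum>z\<in>E. G y z * indicator (?A y z) \<omega>)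
     (\<Sum>y\<in>{..n} \<rightarrow>\<^sub>E E. \<Sum>z\<in>E. G y z * prob (?A y z))"
    by (intro has_bochner_integral_sum has_bochner_integral_mult_right
        has_bochner_integral_real_indicator) (auto simp: emeasure_eq_measure)
  then have "expectation (\<lambda>\<omega>. F (path \<omega>)) = (\<Sum>y\<in>{..n} \<rightarrow>\<^sub>E E. \<Sum>z\<in>E. G y z * prob (?A y z))"
    by (subst Bochner_Integration.integral_cong[OF refl F_eq])
       (auto intro: has_bochner_integral_integral_eq)
  also have "\<dots> = (\<Sum>y\<in>{..n} \<rightarrow>\<^sub>E E. (\<Sum>z\<in>E. p (y n) z * G y z) * \<P>(\<omega> in M. \<forall>k\<le>n. Y k \<omega> = y k))"
  proof (intro sum.cong refl)
    fix y assume y: "y \<in> {..n} \<rightarrow>\<^sub>E E"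
    have "prob (?A y z) = \<P>(\<omega> in M. \<forall>k\<le>n. Y k \<omega> = y k) * p (y n) z" if "z \<in> E" for z
    proof -
      have "?A y z = {\<omega>\<in>space M. \<forall>k\<le>Suc n. Y k \<omega> = (y(Suc n := z)) k}"
        by (auto simp: le_Suc_eq)
      moreover have "{\<omega>\<in>space M. \<forall>k\<le>n. Y k \<omega> = (y(Suc n := z)) k} = {\<omega>\<in>space M. \<forall>k\<le>n. Y k \<omega> = y k}"
        by auto
      ultimately show ?thesis
        using law_Suc[of n "y(Suc n := z)"] PiE_mem[OF y] that by simp
    qed
    then show "(\<Sum>z\<in>E. G y z * prob (?A y z))
        = (\<Sum>z\<in>E. p (y n) z * G y z) * \<P>(\<omega> in M. \<forall>k\<le>n. Y k \<omega> = y k)"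
      by (auto simp: sum_distrib_right mult_ac intro!: sum.cong)
  qed
  also have "\<dots> = expectation (\<lambda>\<omega>. \<Sum>z\<in>E. p (path \<omega> n) z * G (path \<omega>) z)"
  proof (rule has_bochner_integral_integral_eq[symmetric],
      rule prefix_has_bochner_integral[where F = "\<lambda>y. \<Sum>z\<in>E. p (y n) z * G y z"])
    fix y y' :: "nat \<Rightarrow> nat" assume eq: "\<And>k. k \<le> n \<Longrightarrow> y k = y' k"
    show "(\<Sum>z\<in>E. p (y n) z * G y z) = (\<Sum>z\<in>E. p (y' n) z * G y' z)"
      using eq[of n] dep[OF eq] by simp
  qed
  finally show ?thesis .
qed

lemma bounded_prefix_le:
  fixes F G :: "(nat \<Rightarrow> nat) \<Rightarrow> real"
  assumes "\<And>y y'. (\<And>k. k \<le> n \<Longrightarrow> y k = y' k) \<Longrightarrow> F y = F y'"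
    and "\<And>y y'. (\<And>k. k \<le> n \<Longrightarrow> y k = y' k) \<Longrightarrow> G y = G y'"
    and "\<And>y. (\<And>k. y k \<in> E) \<Longrightarrow> F y \<le> G y"
  shows "expectation (\<lambda>\<omega>. F (path \<omega>)) \<le> expectation (\<lambda>\<omega>. G (path \<omega>))"
proof (rule integral_mono)
  show "integrable M (\<lambda>\<omega>. F (path \<omega>))" by (rule prefix_integrable) (rule assms(1))
  show "integrable M (\<lambda>\<omega>. G (path \<omega>))" by (rule prefix_integrable) (rule assms(2))
  show "F (path \<omega>) \<le> G (path \<omega>)" if "\<omega> \<in> space M" for \<omega>
    using assms(3) Y_in_E[OF that] .
qed

end

locale bd_jump_chain = finite_jump_chain M "{0..N}" p Y
  for M :: "'a measure" and N :: nat and p and Y +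
  fixes \<rho> :: real
  assumes N: "1 \<le> N" and \<rho>: "0 < \<rho>"
    and p_0: "p 0 1 = 1" and p_N: "p N (N - 1) = 1"
    and p_down: "\<And>k. 1 \<le> k \<Longrightarrow> k < N \<Longrightarrow> p k (k - 1) = real k / (real k + real (N - k) * \<rho>)"
    and p_up: "\<And>k. 1 \<le> k \<Longrightarrow> k < N \<Longrightarrow>
       p k (Suc k) = real (N - k) * \<rho> / (real k + real (N - k) * \<rho>)"
    and p_other: "\<And>j k. j \<le> N \<Longrightarrow> k \<noteq> Suc j \<Longrightarrow> j \<noteq> Suc k \<Longrightarrow> p j k = 0"
    and Y_0: "AE \<omega> in M. Y 0 \<omega> \<in> {0, 1}"
begin

section \<open>One-step averages of the birth-and-death chain\<close>

lemma sum_p_0: "(\<Sum>z\<in>{0..N}. p 0 z * f z) = (f 1 :: real)"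
proof -
  have "(\<Sum>z\<in>{0..N}. p 0 z * f z) = (\<Sum>z\<in>{0..N}. if z = 1 then f z else 0)"
    using p_other[of 0] p_0 by (intro sum.cong) auto
  then show ?thesis using N by simp
qed

lemma sum_p_N: "(\<Sum>z\<in>{0..N}. p N z * f z) = (f (N - 1) :: real)"
proof -
  have "(\<Sum>z\<in>{0..N}. p N z * f z) = (\<Sum>z\<in>{0..N}. if z = N - 1 then f z else 0)"
    using p_other[of N] p_N N by (intro sum.cong) auto
  then show ?thesis by simp
qed

lemma sum_p_inner:
  assumes "1 \<le> k" "k < N"
  shows "(\<Sum>z\<in>{0..N}. p k z * f z) =
    (real k * f (k - 1) + real (N - k) * \<rho> * f (Suc k)) / (real k + real (N - k) * \<rho>)"
proof -
  have "(\<Sum>z\<in>{0..N}. p k z * f z) =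
    (\<Sum>z\<in>{0..N}. (if z = k - 1 then p k (k - 1) * f z else 0) + (if z = Suc k then p k (Suc k) * f z else 0))"
    using p_other[of k] assms by (intro sum.cong) auto
  also have "\<dots> = p k (k - 1) * f (k - 1) + p k (Suc k) * f (Suc k)"
    using assms by (simp add: sum.distrib)
  finally show ?thesis using assms p_down[of k] p_up[of k] by (simp add: add_divide_distrib)
qed

lemma sum_p_1:
  assumes "k \<le> N"
  shows "(\<Sum>z\<in>{0..N}. p k z) = 1"
proof -
  consider "k = 0" | "k = N" | "1 \<le> k" "k < N" using assms by linarith
  then show ?thesis
  proof cases
    case 3
    then have "0 < real k + real (N - k) * \<rho>" using \<rho> by (intro add_pos_pos) auto
    then show ?thesis using sum_p_inner[OF 3, of "\<lambda>_. 1"] by simp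
  qed (use sum_p_0[of "\<lambda>_. 1"] sum_p_N[of "\<lambda>_. 1"] in auto)
qed

text \<open>The recurrence of the weights balances the expected gain
  \<open>(N - k) * \<rho> * w k\<close> against the expected loss \<open>k * w (k - 1)\<close>.
  State \<open>N\<close> is excluded since the chain can only step down from there.\<close>

lemma bd_scale_harmonic:
  assumes "1 \<le> k" "k < N"
  shows "(\<Sum>z\<in>{0..N}. p k z * bd_scale \<rho> N z) = bd_scale \<rho> N k"
proof -
  obtain j where j: "k = Suc j" using assms by (cases k) auto
  have nz: "real k + real (N - k) * \<rho> > 0" using assms \<rho> by (intro add_pos_pos) auto
  have "real (N - k) * \<rho> * bd_weight \<rho> N k = real k * bd_weight \<rho> N j"
    using bd_weight_Suc[OF \<rho>, of j N] assms \<rho> j by (simp add: bd_ratio_def del: of_nat_Suc)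
  then have "real k * bd_scale \<rho> N (k - 1) + real (N - k) * \<rho> * bd_scale \<rho> N (Suc k)
     = bd_scale \<rho> N k * (real k + real (N - k) * \<rho>)"
    by (simp add: j bd_scale_Suc algebra_simps)
  then show ?thesis using nz by (simp add: sum_p_inner[OF assms])
qed

section \<open>Infinitely many returns to 0\<close>

lemma from_zero_to_one: "AE \<omega> in M. \<forall>n. Y n \<omega> = 0 \<longrightarrow> Y (Suc n) \<omega> = 1"
proof (subst AE_all_countable, intro allI)
  fix n
  let ?A = "{\<omega>\<in>space M. Y n \<omega> = 0 \<and> Y (Suc n) \<omega> \<noteq> 1}"
  have "prob ?A = expectation (\<lambda>\<omega>. of_bool (Y n \<omega> = 0 \<and> Y (Suc n) \<omega> \<noteq> 1))"
    by (rule measure_eq_integral_of_bool) measurable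
  also have "\<dots> = expectation (\<lambda>\<omega>. \<Sum>z\<in>{0..N}. p (Y n \<omega>) z * of_bool (Y n \<omega> = 0 \<and> z \<noteq> 1))"
    by (rule expectation_step[where F = "\<lambda>y. of_bool (y n = 0 \<and> y (Suc n) \<noteq> 1)"
          and G = "\<lambda>y z. of_bool (y n = 0 \<and> z \<noteq> 1)"]) auto
  also have "\<dots> = expectation (\<lambda>\<omega>. 0)"
    using sum_p_0[of "\<lambda>z. of_bool (z \<noteq> 1)"]
    by (intro Bochner_Integration.integral_cong) (auto simp: of_bool_conj)
  finally have "prob ?A = 0" by simp
  then have "?A \<in> null_sets M" by (auto simp: null_sets_def emeasure_eq_measure)
  then show "AE \<omega> in M. Y n \<omega> = 0 \<longrightarrow> Y (Suc n) \<omega> = 1"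
    by (rule AE_I') auto
qed

text \<open>From any positive state the chain steps down with probability at least
  \<open>q = 1 / (1 + N * \<rho>)\<close>. With \<open>\<epsilon> = q / 2\<close> that step alone
  contributes at least \<open>2 * \<epsilon> ^ k\<close>, so the drift is at least
  \<open>\<epsilon> ^ k\<close>, hence at least \<open>\<delta> = \<epsilon> ^ N\<close>.\<close>

lemma geometric_drift:
  "\<exists>\<epsilon>>0. \<exists>\<delta>>0. \<epsilon> \<le> 1 \<and> (\<forall>k\<in>{1..N}. \<epsilon> ^ k + \<delta> \<le> (\<Sum>z\<in>{0..N}. p k z * \<epsilon> ^ z))"
proof -
  define q where "q = 1 / (1 + real N * \<rho>)"
  define \<epsilon> where "\<epsilon> = q / 2"
  have q: "0 < q" "q \<le> 1" using \<rho> by (auto simp: q_def add_pos_nonneg)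
  then have \<epsilon>: "0 < \<epsilon>" "\<epsilon> \<le> 1" "q = 2 * \<epsilon>" by (auto simp: \<epsilon>_def)
  have "\<epsilon> ^ k + \<epsilon> ^ N \<le> (\<Sum>z\<in>{0..N}. p k z * \<epsilon> ^ z)" if k: "k \<in> {1..N}" for k
  proof -
    have "\<epsilon> ^ N \<le> \<epsilon> ^ k" using \<epsilon> k by (intro power_decreasing) auto
    then have "\<epsilon> ^ k + \<epsilon> ^ N \<le> q * \<epsilon> ^ (k - 1)"
      using k \<epsilon> by (cases k) auto
    also have "\<dots> \<le> (\<Sum>z\<in>{0..N}. p k z * \<epsilon> ^ z)"
    proof (cases "k = N")
      case True
      then show ?thesis using q \<epsilon> sum_p_N[of "\<lambda>z. \<epsilon> ^ z"] by (simp add: mult_left_le_one_le)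
    next
      case False
      then have k': "1 \<le> k" "k < N" using k by auto
      have pos: "0 < real k + real (N - k) * \<rho>" using k' \<rho> by (intro add_pos_pos) auto
      have "real (N - k) * \<rho> \<le> real k * (real N * \<rho>)"
      proof -
        have "real (N - k) \<le> real k * real N" using k'
          by (metis diff_le_self le_trans mult_le_mono1 nat_mult_1 of_nat_le_iff of_nat_mult)
        then show ?thesis using \<rho> by (simp add: mult_right_mono mult.assoc[symmetric])
      qed
      then have "real k + real (N - k) * \<rho> \<le> real k * (1 + real N * \<rho>)" by (simp add: algebra_simps)
      then have "q \<le> real k / (real k + real (N - k) * \<rho>)"
        unfolding q_def using pos \<rho> by (simp add: divide_simps add_pos_nonneg mult.commute)
      then have "q * \<epsilon> ^ (k - 1) \<le> real k / (real k + real (N - k) * \<rho>) * \<epsilon> ^ (k - 1)"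
        using \<epsilon> by (intro mult_right_mono) auto
      also have "\<dots> \<le> (\<Sum>z\<in>{0..N}. p k z * \<epsilon> ^ z)"
        using pos \<epsilon> \<rho> by (simp add: sum_p_inner[OF k'] add_divide_distrib)
      finally show ?thesis .
    qed
    finally show ?thesis .
  qed
  then show ?thesis using \<epsilon> by (intro exI[of _ \<epsilon>] conjI exI[of _ "\<epsilon> ^ N"]) auto
qed

text \<open>The expectation of the stopped process grows by at least
  \<open>\<delta> * ?\<alpha>\<close> per step but never exceeds 1, which forces
  \<open>?\<alpha> = 0\<close>.\<close>

lemma prob_avoid_zero: "prob {\<omega>\<in>space M. \<forall>n\<ge>a. Y n \<omega> \<noteq> 0} = 0"
proof -
  obtain \<epsilon> \<delta> where \<epsilon>: "0 < \<epsilon>" "\<epsilon> \<le> 1" "0 < \<delta>"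
    and drift: "\<And>k. k \<in> {1..N} \<Longrightarrow> \<epsilon> ^ k + \<delta> \<le> (\<Sum>z\<in>{0..N}. p k z * \<epsilon> ^ z)"
    using geometric_drift by blast
  define alive where "alive = (\<lambda>n y. \<forall>k\<in>{a..n}. y k \<noteq> (0::nat))"
  \<comment> \<open>the stopped process \<open>\<epsilon> ^ Y\<close>: after the first zero it stays at \<open>1 = \<epsilon> ^ 0\<close>\<close>
  define g where "g = (\<lambda>n y. if alive n y then \<epsilon> ^ y n else 1)"
  let ?\<alpha> = "prob {\<omega>\<in>space M. \<forall>n\<ge>a. Y n \<omega> \<noteq> 0}"
  have dep_alive: "alive n y = alive n y'" if "\<And>k. k \<le> n \<Longrightarrow> y k = y' k" for n y y'
    using that by (auto simp: alive_def)
  have dep_g: "g n y = g n y'" if "\<And>k. k \<le> n \<Longrightarrow> y k = y' k" for n y y'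
    using that dep_alive[OF that] by (simp add: g_def)
  have g_integrable: "integrable M (\<lambda>\<omega>. g n (path \<omega>))" for n
    by (rule prefix_integrable[where F = "g n"]) (rule dep_g)
  have alive_integrable: "integrable M (\<lambda>\<omega>. of_bool (alive n (path \<omega>)) :: real)" for n
    by (rule prefix_integrable[where F = "\<lambda>y. of_bool (alive n y)"]) (rule arg_cong[where f = of_bool], rule dep_alive)
  have alive_sets: "{\<omega>\<in>space M. alive n (path \<omega>)} \<in> sets M" for n
    by (rule prefix_sets[OF dep_alive])
  have step: "expectation (\<lambda>\<omega>. g n (path \<omega>)) + \<delta> * ?\<alpha> \<le> expectation (\<lambda>\<omega>. g (Suc n) (path \<omega>))"
    if n: "a \<le> n" for n
  proof -
    have "?\<alpha> \<le> prob {\<omega>\<in>space M. alive n (path \<omega>)}"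
    proof (rule finite_measure_mono)
      show "{\<omega>\<in>space M. \<forall>n\<ge>a. Y n \<omega> \<noteq> 0} \<subseteq> {\<omega>\<in>space M. alive n (path \<omega>)}"
        by (simp add: alive_def Collect_mono)
    qed (rule alive_sets)
    also have "\<dots> = expectation (\<lambda>\<omega>. of_bool (alive n (path \<omega>)))"
      by (rule measure_eq_integral_of_bool) (rule alive_sets)
    finally have "expectation (\<lambda>\<omega>. g n (path \<omega>)) + \<delta> * ?\<alpha>
       \<le> expectation (\<lambda>\<omega>. g n (path \<omega>)) + \<delta> * expectation (\<lambda>\<omega>. of_bool (alive n (path \<omega>)))"
      using \<epsilon> by simp
    also have "\<dots> = expectation (\<lambda>\<omega>. g n (path \<omega>) + \<delta> * of_bool (alive n (path \<omega>)))"
      by (subst Bochner_Integration.integral_add)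
         (use g_integrable[of n] alive_integrable[of n] in auto)
    also have "\<dots> \<le> expectation (\<lambda>\<omega>. \<Sum>z\<in>{0..N}. p (path \<omega> n) z * (if alive n (path \<omega>) then \<epsilon> ^ z else 1))"
    proof (rule bounded_prefix_le[where n = n and F = "\<lambda>y. g n y + \<delta> * of_bool (alive n y)"
          and G = "\<lambda>y. \<Sum>z\<in>{0..N}. p (y n) z * (if alive n y then \<epsilon> ^ z else 1)"])
      fix y :: "nat \<Rightarrow> nat" assume y: "\<And>k. y k \<in> {0..N}"
      show "g n y + \<delta> * of_bool (alive n y)
          \<le> (\<Sum>z\<in>{0..N}. p (y n) z * (if alive n y then \<epsilon> ^ z else 1))"
      proof (cases "alive n y")
        case True
        then have "y n \<in> {1..N}" using n y[of n] True[unfolded alive_def, rule_format, of n] by simp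
        then show ?thesis using drift[of "y n"] True by (simp add: g_def)
      next
        case False
        then show ?thesis using sum_p_1[of "y n"] y[of n] by (simp add: g_def)
      qed
    next
      fix y y' :: "nat \<Rightarrow> nat" assume eq: "\<And>k. k \<le> n \<Longrightarrow> y k = y' k"
      show "g n y + \<delta> * of_bool (alive n y) = g n y' + \<delta> * of_bool (alive n y')"
        using dep_g[OF eq] dep_alive[OF eq] by simp
      show "(\<Sum>z\<in>{0..N}. p (y n) z * (if alive n y then \<epsilon> ^ z else 1))
         = (\<Sum>z\<in>{0..N}. p (y' n) z * (if alive n y' then \<epsilon> ^ z else 1))"
        using eq[of n] dep_alive[OF eq] by simp
    qed
    also have "\<dots> = expectation (\<lambda>\<omega>. g (Suc n) (path \<omega>))"
    proof (rule expectation_step[symmetric])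
      fix y y' :: "nat \<Rightarrow> nat" and z assume eq: "\<And>k. k \<le> n \<Longrightarrow> y k = y' k"
      show "(if alive n y then \<epsilon> ^ z else 1) = (if alive n y' then \<epsilon> ^ z else 1)"
        using dep_alive[OF eq] by simp
    next
      fix y :: "nat \<Rightarrow> nat"
      have "alive (Suc n) y \<longleftrightarrow> alive n y \<and> y (Suc n) \<noteq> 0"
        using n by (auto simp: alive_def le_Suc_eq)
      then show "g (Suc n) y = (if alive n y then \<epsilon> ^ y (Suc n) else 1)"
        by (auto simp: g_def)
    qed
    finally show ?thesis .
  qed
  have g_bounds: "0 \<le> g n y" "g n y \<le> 1" for n y
    using \<epsilon> by (auto simp: g_def power_le_one)
  have lower: "real n * (\<delta> * ?\<alpha>) \<le> expectation (\<lambda>\<omega>. g (a + n) (path \<omega>))" for n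
  proof (induction n)
    case 0
    then show ?case using g_bounds by (simp add: integral_nonneg)
  next
    case (Suc n)
    then show ?case using step[of "a + n"] by (simp add: algebra_simps)
  qed
  have upper: "expectation (\<lambda>\<omega>. g n (path \<omega>)) \<le> 1" for n
    using integral_mono[OF g_integrable[of n], of "\<lambda>_. 1"] g_bounds by (simp add: prob_space)
  show ?thesis
  proof (rule ccontr)
    assume "\<not> ?thesis"
    then have "0 < \<delta> * ?\<alpha>" using \<epsilon> by (simp add: zero_less_measure_iff)
    then obtain n where "1 < real n * (\<delta> * ?\<alpha>)" using reals_Archimedean3 by blast
    then show False using lower[of n] upper[of "a + n"] by linarith
  qed
qed

lemma recurrent: "AE \<omega> in M. \<forall>a. \<exists>n\<ge>a. Y n \<omega> = 0"
proof (subst AE_all_countable, intro allI)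
  fix a
  have "{\<omega>\<in>space M. \<forall>n\<ge>a. Y n \<omega> \<noteq> 0} \<in> null_sets M"
    using prob_avoid_zero[of a] by (auto simp: null_sets_def emeasure_eq_measure)
  then show "AE \<omega> in M. \<exists>n\<ge>a. Y n \<omega> = 0"
    by (rule AE_I') auto
qed

lemma visits_zero_and_positive:
  "AE \<omega> in M. (\<forall>a. \<exists>n\<ge>a. Y n \<omega> = 0) \<and> (\<forall>a. \<exists>n\<ge>a. 0 < Y n \<omega>)"
  using recurrent from_zero_to_one
proof eventually_elim
  case (elim \<omega>)
  have "\<exists>n\<ge>a. 0 < Y n \<omega>" for a
  proof -
    obtain n where "a \<le> n" "Y n \<omega> = 0" using elim(1) by blast
    then show ?thesis using elim(2) by (intro exI[of _ "Suc n"]) auto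
  qed
  then show ?case using elim(1) by blast
qed

section \<open>The martingale for reaching level m in excursion i\<close>

context
  fixes i m :: nat
  assumes i: "1 \<le> i" and m: "1 \<le> m" "m \<le> N"
begin

definition reached :: "nat \<Rightarrow> (nat \<Rightarrow> nat) \<Rightarrow> bool" where
  "reached n y \<longleftrightarrow> (\<exists>j\<le>n. exc_count y j = i \<and> m \<le> y j)"

text \<open>The conditional probability, given the first \<open>n\<close> jumps, that excursion \<open>i\<close> reaches \<open>m\<close>.\<close>

definition reach_value :: "nat \<Rightarrow> (nat \<Rightarrow> nat) \<Rightarrow> real" where
  "reach_value n y =
     (if exc_count y n < i then 1 / bd_scale \<rho> N m
      else if reached n y then 1
      else if exc_count y n = i then bd_scale \<rho> N (y n) / bd_scale \<rho> N m
      else 0)"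

lemma scale_pos: "0 < bd_scale \<rho> N m"
  using bd_scale_ge_1[OF \<rho> m(1), of N] by linarith

lemma scale_1: "bd_scale \<rho> N (Suc 0) = 1"
  by (simp add: bd_scale_def)

lemma reached_cong:
  assumes "\<And>k. k \<le> n \<Longrightarrow> y k = y' k"
  shows "reached n y = reached n y'"
proof -
  have "exc_count y j = exc_count y' j" if "j \<le> n" for j
    by (rule exc_count_cong) (use assms that in simp)
  then show ?thesis using assms unfolding reached_def by (metis (no_types, lifting))
qed

lemma reach_value_cong:
  assumes "\<And>k. k \<le> n \<Longrightarrow> y k = y' k"
  shows "reach_value n y = reach_value n y'"
  unfolding reach_value_def
  using reached_cong[OF assms] exc_count_cong[of n y y'] assms by simp

lemma reached_Suc: "reached (Suc n) y \<longleftrightarrow> reached n y \<or> exc_count y (Suc n) = i \<and> m \<le> y (Suc n)"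
  unfolding reached_def by (auto simp: le_Suc_eq simp del: exc_count.simps)

lemma not_reached_before: "exc_count y n < i \<Longrightarrow> \<not> reached n y"
  unfolding reached_def using exc_count_mono[of _ n y] by fastforce

lemma reached_current: "exc_count y n = i \<Longrightarrow> m \<le> y n \<Longrightarrow> reached n y"
  unfolding reached_def by (rule exI[of _ n]) simp

lemma reach_value_bounds: "0 \<le> reach_value n y" "reach_value n y \<le> 1"
proof -
  have "bd_scale \<rho> N (y n) \<le> bd_scale \<rho> N m" if "exc_count y n = i" "\<not> reached n y"
    using that reached_current[of y n] by (intro bd_scale_mono \<rho>) linarith
  moreover have "0 \<le> bd_scale \<rho> N (y n)"
    using bd_scale_mono[OF \<rho>, of 0 "y n"] by simp
  ultimately show "0 \<le> reach_value n y" "reach_value n y \<le> 1"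
    using scale_pos bd_scale_ge_1[OF \<rho> m(1), of N] by (auto simp: reach_value_def)
qed

text \<open>At 0 the next state is 1: entering excursion \<open>i\<close> gives
  \<open>1 / bd_scale \<rho> N m\<close> because the scale at 1 is 1, and leaving it unsuccessfully
  gives 0 because the scale at 0 is 0. Inside excursion \<open>i\<close> below \<open>m\<close> the
  scale is harmonic, and in all other cases the value is frozen.\<close>

lemma reach_value_step:
  assumes "y n \<le> N"
  shows "(\<Sum>z\<in>{0..N}. p (y n) z * reach_value (Suc n) (y(Suc n := z))) = reach_value n y"
proof -
  have cnt: "exc_count (y(Suc n := z)) n = exc_count y n" for z
    by (rule exc_count_cong) simp
  have rch: "reached n (y(Suc n := z)) = reached n y" for z
    by (rule reached_cong) simp
  show ?thesis
  proof (cases "y n = 0")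
    case True
    have "reach_value (Suc n) (y(Suc n := 1)) = reach_value n y"
      unfolding reach_value_def reached_Suc rch
      using True m scale_1 scale_pos not_reached_before[of y n] cnt[of 1]
      by (cases "m = 1") auto
    then show ?thesis
      using sum_p_0[of "\<lambda>z. reach_value (Suc n) (y(Suc n := z))"] True by simp
  next
    case False
    have cnt': "exc_count (y(Suc n := z)) (Suc n) = exc_count y n" for z
      using False cnt by simp
    show ?thesis
    proof (cases "exc_count y n = i \<and> \<not> reached n y")
      case True
      then have "y n < m" using reached_current[of y n] by linarith
      \<comment> \<open>A neighbour of a state below \<open>m\<close> is at most \<open>m\<close>;
        at \<open>z = m\<close> the level has just been reached, and both formulas for the value
        equal 1.\<close>
      have "p (y n) z * reach_value (Suc n) (y(Suc n := z))
          = p (y n) z * bd_scale \<rho> N z / bd_scale \<rho> N m" for z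
      proof (cases "z = Suc (y n) \<or> y n = Suc z")
        case True
        with \<open>y n < m\<close> have "z \<le> m" by auto
        then show ?thesis
          using \<open>exc_count y n = i \<and> _\<close> cnt' rch scale_pos by (auto simp: reach_value_def reached_Suc)
      next
        case False
        then show ?thesis using p_other[OF assms, of z] by auto
      qed
      then have "(\<Sum>z\<in>{0..N}. p (y n) z * reach_value (Suc n) (y(Suc n := z)))
        = (\<Sum>z\<in>{0..N}. p (y n) z * bd_scale \<rho> N z) / bd_scale \<rho> N m"
        by (simp add: sum_divide_distrib)
      also have "\<dots> = bd_scale \<rho> N (y n) / bd_scale \<rho> N m"
        using bd_scale_harmonic[of "y n"] \<open>y n < m\<close> m False by simp
      finally show ?thesis using True by (simp add: reach_value_def)
    next
      case not_current: False
      have "reach_value (Suc n) (y(Suc n := z)) = reach_value n y" for z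
        using not_current cnt'[of z] rch[of z]
        by (auto simp: reach_value_def reached_Suc simp del: exc_count.simps)
      then show ?thesis
        using sum_p_1[OF assms] by (simp add: sum_distrib_right[symmetric])
    qed
  qed
qed

text \<open>The martingale keeps its initial mean. Starting in \<open>{0, 1}\<close> makes the
  initial value deterministic, also when \<open>i = 1\<close> and the excursion is already under
  way.\<close>

lemma expectation_reach_value: "expectation (\<lambda>\<omega>. reach_value n (path \<omega>)) = 1 / bd_scale \<rho> N m"
proof (induction n)
  case 0
  have "AE \<omega> in M. reach_value 0 (path \<omega>) = 1 / bd_scale \<rho> N m"
    using Y_0
  proof eventually_elim
    case (elim \<omega>)
    then show ?case
      unfolding reach_value_def reached_def
      using i m scale_1 scale_pos by (cases "m = 1") auto
  qed
  moreover have "(\<lambda>\<omega>. reach_value 0 (path \<omega>)) \<in> borel_measurable M"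
    by (rule prefix_measurable[where F = "reach_value 0"]) (rule reach_value_cong)
  ultimately have "expectation (\<lambda>\<omega>. reach_value 0 (path \<omega>)) = expectation (\<lambda>\<omega>. 1 / bd_scale \<rho> N m)"
    by (intro integral_cong_AE) auto
  then show ?case by (simp add: prob_space)
next
  case (Suc n)
  have "expectation (\<lambda>\<omega>. reach_value (Suc n) (path \<omega>)) =
     expectation (\<lambda>\<omega>. \<Sum>z\<in>{0..N}. p (Y n \<omega>) z * reach_value (Suc n) ((path \<omega>)(Suc n := z)))"
  proof (rule expectation_step)
    fix y y' :: "nat \<Rightarrow> nat" and z assume "\<And>k. k \<le> n \<Longrightarrow> y k = y' k"
    then show "reach_value (Suc n) (y(Suc n := z)) = reach_value (Suc n) (y'(Suc n := z))"
      by (intro reach_value_cong) (auto simp: le_Suc_eq)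
  qed simp
  also have "\<dots> = expectation (\<lambda>\<omega>. reach_value n (path \<omega>))"
    using Y_in_E[of _ n] by (intro Bochner_Integration.integral_cong refl reach_value_step) auto
  finally show ?case using Suc by simp
qed

lemma reach_event: "{\<omega>\<in>space M. \<exists>j. exc_count (path \<omega>) j = i \<and> m \<le> Y j \<omega>} \<in> sets M"
proof -
  have "{\<omega>\<in>space M. exc_count (path \<omega>) j = i \<and> m \<le> Y j \<omega>} \<in> sets M" for j
  proof (rule prefix_sets[where n = j and P = "\<lambda>y. exc_count y j = i \<and> m \<le> y j"])
    fix y y' :: "nat \<Rightarrow> nat" assume "\<And>k. k \<le> j \<Longrightarrow> y k = y' k"
    then show "(exc_count y j = i \<and> m \<le> y j) = (exc_count y' j = i \<and> m \<le> y' j)"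
      using exc_count_cong[of j y y'] by simp
  qed
  then show ?thesis by (rule sets.sets_Collect_countable_Ex)
qed

text \<open>On a recurrent path excursion \<open>i\<close> ends after finitely many jumps, and from
  the start of the next one the value equals the indicator.\<close>

lemma reach_value_tendsto:
  assumes z: "\<And>a. \<exists>n\<ge>a. y n = 0" and p: "\<And>a. \<exists>n\<ge>a. 0 < y n"
  shows "(\<lambda>n. reach_value n y) \<longlonglongrightarrow> of_bool (\<exists>j. exc_count y j = i \<and> m \<le> y j)"
proof (rule tendsto_eventually)
  obtain a where a: "Suc i \<le> exc_count y a" using exc_count_unbounded[OF z p] by blast
  show "\<forall>\<^sub>F n in sequentially. reach_value n y = of_bool (\<exists>j. exc_count y j = i \<and> m \<le> y j)"
    using eventually_ge_at_top[of a]
  proof eventually_elim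
    case (elim n)
    then have n: "i < exc_count y n" using a exc_count_mono[of a n y] by linarith
    have "j \<le> n" if "exc_count y j = i" for j
      using exc_count_mono[of n j y] n that by (metis leD nat_le_linear)
    then have "reached n y \<longleftrightarrow> (\<exists>j. exc_count y j = i \<and> m \<le> y j)"
      unfolding reached_def by blast
    then show ?case using n by (auto simp: reach_value_def)
  qed
qed

lemma prob_reach: "\<P>(\<omega> in M. \<exists>j. exc_count (path \<omega>) j = i \<and> m \<le> Y j \<omega>) = 1 / bd_scale \<rho> N m"
proof -
  let ?Q = "\<lambda>\<omega>. \<exists>j. exc_count (path \<omega>) j = i \<and> m \<le> Y j \<omega>"
  have "(\<lambda>n. expectation (\<lambda>\<omega>. reach_value n (path \<omega>))) \<longlonglongrightarrow> expectation (\<lambda>\<omega>. of_bool (?Q \<omega>))"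
  proof (rule integral_dominated_convergence[where w = "\<lambda>_. 1"])
    have "(\<lambda>\<omega>. of_bool (?Q \<omega>) :: real) \<in> borel_measurable M \<longleftrightarrow>
      (indicator {\<omega>\<in>space M. ?Q \<omega>} :: _ \<Rightarrow> real) \<in> borel_measurable M"
      by (rule measurable_cong) (simp add: indicator_def)
    then show "(\<lambda>\<omega>. of_bool (?Q \<omega>) :: real) \<in> borel_measurable M"
      using reach_event by simp
    show "(\<lambda>\<omega>. reach_value n (path \<omega>)) \<in> borel_measurable M" for n
      by (rule prefix_measurable[where F = "reach_value n"]) (rule reach_value_cong)
    show "AE \<omega> in M. (\<lambda>n. reach_value n (path \<omega>)) \<longlonglongrightarrow> of_bool (?Q \<omega>)"
      using visits_zero_and_positive
    proof eventually_elim
      case (elim \<omega>)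
      then show ?case by (intro reach_value_tendsto) auto
    qed
    show "AE \<omega> in M. norm (reach_value n (path \<omega>)) \<le> 1" for n
      using reach_value_bounds by (intro AE_I2) simp
  qed simp
  then have "expectation (\<lambda>\<omega>. of_bool (?Q \<omega>)) = 1 / bd_scale \<rho> N m"
    unfolding expectation_reach_value by (simp add: LIMSEQ_const_iff)
  then show ?thesis using measure_eq_integral_of_bool[OF reach_event] by simp
qed

end

end

section \<open>The height of an excursion\<close>

text \<open>Extracts the discrete chain from the continuous-time model by taking all holding-time
  thresholds equal to 0, which removes the exponential factors.\<close>

lemma bd_jump_chain_of_ctmc:
  assumes \<mu>: "\<mu> > 0" and \<nu>: "\<nu> > 0" and N: "1 \<le> N"
    and ctmc: "ctmc M {0..N} (bd_Q \<mu> \<nu> N) X"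
    and X_0: "AE \<omega> in M. X 0 \<omega> \<in> {0, 1}"
  obtains Y S where "bd_jump_chain M N (jump_prob (bd_Q \<mu> \<nu> N)) Y (\<nu> / \<mu>)"
    and "AE \<omega> in M. step_path (\<lambda>t. X t \<omega>) (\<lambda>n. Y n \<omega>) (\<lambda>n. \<Sum>k<n. S k \<omega>)"
proof -
  let ?p = "jump_prob (bd_Q \<mu> \<nu> N)"
  interpret prob_space M using ctmc by (simp add: ctmc_def)
  from ctmc obtain Y S where law: "jump_hold_law M {0..N} (bd_Q \<mu> \<nu> N) Y S"
    and good: "AE \<omega> in M. (\<forall>n. 0 < S n \<omega>) \<and>
           filterlim (\<lambda>n. \<Sum>k<n. S k \<omega>) at_top sequentially \<and>
           (\<forall>n t. (\<Sum>k<n. S k \<omega>) \<le> t \<and> t < (\<Sum>k<Suc n. S k \<omega>) \<longrightarrow> X t \<omega> = Y n \<omega>)"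
    unfolding ctmc_def by blast
  have X_E: "X t \<omega> \<in> {0..N}" if "0 \<le> t" "\<omega> \<in> space M" for t \<omega>
    using ctmc that by (simp add: ctmc_def)
  have Y_measurable [measurable]: "Y n \<in> measurable M (count_space UNIV)"
    and S_measurable [measurable]: "S n \<in> borel_measurable M" for n
    using law by (auto simp: jump_hold_law_def)
  \<comment> \<open>\<open>Y\<close> lies in the state space only almost surely, as \<open>X\<close>
    evaluated at jump times. Redefining it on the exceptional null set makes this true
    everywhere.\<close>
  define Z where "Z n \<omega> = (if Y n \<omega> \<in> {0..N} then Y n \<omega> else 0)" for n \<omega>
  have Z_measurable [measurable]: "Z n \<in> measurable M (count_space UNIV)" for n
    unfolding Z_def
    by (rule measurable_compose[where g = "\<lambda>k. if k \<in> {0..N} then k else 0", OF Y_measurable]) simp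
  have path: "AE \<omega> in M. step_path (\<lambda>t. X t \<omega>) (\<lambda>n. Y n \<omega>) (\<lambda>n. \<Sum>k<n. S k \<omega>)
      \<and> (\<forall>n. 0 < S n \<omega>)"
    using good
  proof eventually_elim
    case (elim \<omega>)
    show ?case by (intro conjI step_path.intro) (use elim in auto)
  qed
  have "AE \<omega> in M. \<forall>n. Z n \<omega> = Y n \<omega>"
    using path AE_space
  proof eventually_elim
    case (elim \<omega>)
    then interpret step_path "\<lambda>t. X t \<omega>" "\<lambda>n. Y n \<omega>" "\<lambda>n. \<Sum>k<n. S k \<omega>" by simp
    have "Y n \<omega> \<in> {0..N}" for n
    proof -
      have "0 \<le> (\<Sum>k<n. S k \<omega>)" using elim by (intro sum_nonneg) (auto intro: less_imp_le)
      then show ?thesis using X_E[of "\<Sum>k<n. S k \<omega>" \<omega>] elim x_T[of n] by simp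
    qed
    then show ?case by (simp add: Z_def)
  qed
  with path have path_Z: "AE \<omega> in M. step_path (\<lambda>t. X t \<omega>) (\<lambda>n. Z n \<omega>) (\<lambda>n. \<Sum>k<n. S k \<omega>)
      \<and> (\<forall>n. 0 < S n \<omega>) \<and> (\<forall>n. Z n \<omega> = Y n \<omega>)"
    by eventually_elim (simp add: fun_eq_iff)
  have law_Z: "\<P>(\<omega> in M. \<forall>k\<le>n. Z k \<omega> = y k) = \<P>(\<omega> in M. Y 0 \<omega> = y 0) * (\<Prod>k<n. ?p (y k) (y (Suc k)))"
    if "\<And>k. k \<le> n \<Longrightarrow> y k \<in> {0..N}" for n y
  proof -
    have "\<P>(\<omega> in M. \<forall>k\<le>n. Z k \<omega> = y k) = \<P>(\<omega> in M. (\<forall>k\<le>n. Y k \<omega> = y k) \<and> (\<forall>k<n. 0 < S k \<omega>))"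
    proof (rule prob_eq_AE)
      show "AE \<omega> in M. (\<forall>k\<le>n. Z k \<omega> = y k) \<longleftrightarrow> (\<forall>k\<le>n. Y k \<omega> = y k) \<and> (\<forall>k<n. 0 < S k \<omega>)"
        using path_Z by eventually_elim auto
    qed measurable
    also have "\<dots> = \<P>(\<omega> in M. Y 0 \<omega> = y 0) *
          (\<Prod>k<n. ?p (y k) (y (Suc k)) * exp (- exit_rate (bd_Q \<mu> \<nu> N) (y k) * (\<lambda>_. 0) k))"
      using law that unfolding jump_hold_law_def by (elim conjE allE[of _ n] allE[of _ y] allE[of _ "\<lambda>_. 0"]) auto
    finally show ?thesis by simp
  qed
  have "bd_jump_chain M N ?p Z (\<nu> / \<mu>)"
  proof (intro bd_jump_chain.intro finite_jump_chain.intro finite_jump_chain_axioms.intro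
      bd_jump_chain_axioms.intro)
    show "prob_space M" by (rule prob_space_axioms)
    show "Z n \<omega> \<in> {0..N}" for n \<omega> by (simp add: Z_def)
    show "\<P>(\<omega> in M. \<forall>k\<le>Suc n. Z k \<omega> = y k) = \<P>(\<omega> in M. \<forall>k\<le>n. Z k \<omega> = y k) * ?p (y n) (y (Suc n))"
      if "\<And>k. k \<le> Suc n \<Longrightarrow> y k \<in> {0..N}" for n y
      using law_Z[of "Suc n" y] law_Z[of n y] that by simp
    show "?p k (k - 1) = real k / (real k + real (N - k) * (\<nu> / \<mu>))" if "1 \<le> k" "k < N" for k
      using jump_prob_bd_Q(1)[OF \<mu> \<nu>] that by simp
    show "?p k (Suc k) = real (N - k) * (\<nu> / \<mu>) / (real k + real (N - k) * (\<nu> / \<mu>))"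
      if "1 \<le> k" "k < N" for k
      using jump_prob_bd_Q(2)[OF \<mu> \<nu>] that by simp
    show "?p j k = 0" if "j \<le> N" "k \<noteq> Suc j" "j \<noteq> Suc k" for j k
      using that by (simp add: jump_prob_def bd_Q_def)
    show "AE \<omega> in M. Z 0 \<omega> \<in> {0, 1}"
      using path_Z X_0
    proof eventually_elim
      case (elim \<omega>)
      then interpret step_path "\<lambda>t. X t \<omega>" "\<lambda>n. Z n \<omega>" "\<lambda>n. \<Sum>k<n. S k \<omega>" by blast
      show ?case using x_T[of 0] elim by simp
    qed
  qed (use jump_prob_bd_Q_boundary[OF \<mu> \<nu> N] \<mu> \<nu> N in auto)
  moreover have "AE \<omega> in M. step_path (\<lambda>t. X t \<omega>) (\<lambda>n. Z n \<omega>) (\<lambda>n. \<Sum>k<n. S k \<omega>)"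
    using path_Z by eventually_elim blast
  ultimately show ?thesis by (rule that)
qed

lemma bd_height_law:
  assumes \<mu>: "\<mu> > 0" and \<nu>: "\<nu> > 0" and N: "1 \<le> N" and i: "1 \<le> i"
    and H: "bd_height \<mu> \<nu> N M X i H"
  shows "AE \<omega> in M. H \<omega> \<le> N"
    and "\<And>m. 1 \<le> m \<Longrightarrow> m \<le> N \<Longrightarrow> \<P>(\<omega> in M. m \<le> H \<omega>) = 1 / bd_scale (\<nu> / \<mu>) N m"
proof -
  have ctmc: "ctmc M {0..N} (bd_Q \<mu> \<nu> N) X" and X_0: "AE \<omega> in M. X 0 \<omega> \<in> {0, 1}"
    and H_measurable [measurable]: "H \<in> measurable M (count_space UNIV)"
    and H_eq: "AE \<omega> in M. H \<omega> = exc_height (\<lambda>t. X t \<omega>) i"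
    using H by (auto simp: bd_height_def)
  obtain Y S where chain: "bd_jump_chain M N (jump_prob (bd_Q \<mu> \<nu> N)) Y (\<nu> / \<mu>)"
    and path: "AE \<omega> in M. step_path (\<lambda>t. X t \<omega>) (\<lambda>n. Y n \<omega>) (\<lambda>n. \<Sum>k<n. S k \<omega>)"
    using bd_jump_chain_of_ctmc[OF \<mu> \<nu> N ctmc X_0] .
  interpret bd_jump_chain M N "jump_prob (bd_Q \<mu> \<nu> N)" Y "\<nu> / \<mu>" by (rule chain)
  have height: "AE \<omega> in M. \<forall>m\<ge>1. m \<le> H \<omega> \<longleftrightarrow> (\<exists>j. exc_count (\<lambda>k. Y k \<omega>) j = i \<and> m \<le> Y j \<omega>)"
    using H_eq path visits_zero_and_positive
  proof eventually_elim
    case (elim \<omega>)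
    then interpret step_path "\<lambda>t. X t \<omega>" "\<lambda>n. Y n \<omega>" "\<lambda>n. \<Sum>k<n. S k \<omega>" by simp
    show ?case using exc_height_ge_iff[of i] elim i by simp
  qed
  show "AE \<omega> in M. H \<omega> \<le> N"
    using height AE_space
  proof eventually_elim
    case (elim \<omega>)
    \<comment> \<open>The height equivalence holds for every level \<open>m \<ge> 1\<close>, so it
      can be applied at the unreachable level \<open>Suc N\<close>.\<close>
    then have "\<not> Suc N \<le> Y j \<omega>" for j using Y_in_E[of \<omega> j] by simp
    then have "\<not> Suc N \<le> H \<omega>" using elim by (metis One_nat_def le_add1 plus_1_eq_Suc)
    then show ?case by simp
  qed
  fix m assume m: "1 \<le> m" "m \<le> N"
  have "\<P>(\<omega> in M. m \<le> H \<omega>) = \<P>(\<omega> in M. \<exists>j. exc_count (\<lambda>k. Y k \<omega>) j = i \<and> m \<le> Y j \<omega>)"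
  proof (rule prob_eq_AE)
    show "AE \<omega> in M. m \<le> H \<omega> \<longleftrightarrow> (\<exists>j. exc_count (\<lambda>k. Y k \<omega>) j = i \<and> m \<le> Y j \<omega>)"
      using height by eventually_elim (use m in blast)
    show "{\<omega>\<in>space M. m \<le> H \<omega>} \<in> events" by measurable
  qed (rule reach_event[OF i m])
  also have "\<dots> = 1 / bd_scale (\<nu> / \<mu>) N m" by (rule prob_reach[OF i m])
  finally show "\<P>(\<omega> in M. m \<le> H \<omega>) = 1 / bd_scale (\<nu> / \<mu>) N m" .
qed

section \<open>Concentration of the height around its mean\<close>

lemma abs_diff_eq_tail_counts:
  fixes h c N :: nat
  assumes "h \<le> N" "c \<le> N"
  shows "\<bar>real h - real c\<bar> = (\<Sum>m\<in>{c<..N}. of_bool (m \<le> h)) + (\<Sum>m\<in>{1..c}. 1 - of_bool (m \<le> h))"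
proof -
  have "(\<Sum>m\<in>{c<..N}. of_bool (m \<le> h)) = real (card ({c<..N} \<inter> {m. m \<le> h}))"
    by simp
  also have "{c<..N} \<inter> {m. m \<le> h} = {c<..h}" using assms by auto
  finally have 1: "(\<Sum>m\<in>{c<..N}. of_bool (m \<le> h)) = real (h - c)" by simp
  have "(\<Sum>m\<in>{1..c}. 1 - of_bool (m \<le> h)) = (\<Sum>m\<in>{1..c}. of_bool (h < m) :: real)"
    by (intro sum.cong) auto
  also have "\<dots> = real (card ({1..c} \<inter> {m. h < m}))" by simp
  also have "{1..c} \<inter> {m. h < m} = {h<..c}" by auto
  finally have 2: "(\<Sum>m\<in>{1..c}. 1 - of_bool (m \<le> h)) = real (c - h)" by simp
  show ?thesis unfolding 1 2 by (cases "h \<le> c") auto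
qed

text \<open>Counting the integer levels between \<open>H\<close> and \<open>c\<close> brings the
  mean distance down to the tail probabilities, the only part of the law that is computed.\<close>

lemma (in prob_space) expectation_abs_diff_tail:
  fixes H :: "'a \<Rightarrow> nat"
  assumes [measurable]: "H \<in> measurable M (count_space UNIV)"
    and H: "AE \<omega> in M. H \<omega> \<le> N" and c: "c \<le> N"
  shows "expectation (\<lambda>\<omega>. \<bar>real (H \<omega>) - real c\<bar>) =
    (\<Sum>m\<in>{c<..N}. \<P>(\<omega> in M. m \<le> H \<omega>)) + (\<Sum>m\<in>{1..c}. 1 - \<P>(\<omega> in M. m \<le> H \<omega>))"
proof -
  have int: "has_bochner_integral M (\<lambda>\<omega>. of_bool (m \<le> H \<omega>) :: real) (\<P>(\<omega> in M. m \<le> H \<omega>))" for m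
  proof -
    have "integrable M (\<lambda>\<omega>. of_bool (m \<le> H \<omega>) :: real)"
      by (rule integrable_const_bound[of _ 1]) auto
    then show ?thesis
      using measure_eq_integral_of_bool[of "\<lambda>\<omega>. m \<le> H \<omega>"] by (simp add: has_bochner_integral_iff)
  qed
  have one: "has_bochner_integral M (\<lambda>_. 1 :: real) 1"
    by (simp add: has_bochner_integral_iff prob_space)
  have "expectation (\<lambda>\<omega>. \<bar>real (H \<omega>) - real c\<bar>) = expectation (\<lambda>\<omega>.
     (\<Sum>m\<in>{c<..N}. of_bool (m \<le> H \<omega>)) + (\<Sum>m\<in>{1..c}. 1 - of_bool (m \<le> H \<omega>)))"
    using H by (intro integral_cong_AE) (auto elim!: eventually_mono simp: abs_diff_eq_tail_counts[OF _ c])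
  also have "\<dots> = (\<Sum>m\<in>{c<..N}. \<P>(\<omega> in M. m \<le> H \<omega>)) + (\<Sum>m\<in>{1..c}. 1 - \<P>(\<omega> in M. m \<le> H \<omega>))"
    by (intro has_bochner_integral_integral_eq has_bochner_integral_add has_bochner_integral_sum
        has_bochner_integral_diff int one)
  finally show ?thesis .
qed

text \<open>Passing from the centre \<open>c\<close> to the mean at most doubles the mean absolute
  deviation, because the mean itself is within \<open>C\<close> of \<open>c\<close>; Markov's
  inequality then applies.\<close>

lemma (in prob_space) prob_deviation_le:
  fixes f :: "'a \<Rightarrow> real"
  assumes f: "integrable M f" and C: "expectation (\<lambda>\<omega>. \<bar>f \<omega> - c\<bar>) \<le> C" and a: "0 < a"
  shows "\<P>(\<omega> in M. a \<le> \<bar>f \<omega> - expectation f\<bar>) \<le> 2 * C / a"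
proof -
  have "\<bar>expectation f - c\<bar> = \<bar>expectation (\<lambda>\<omega>. f \<omega> - c)\<bar>"
    using f by (simp add: prob_space)
  also have "\<dots> \<le> C" using integral_abs_bound[of M "\<lambda>\<omega>. f \<omega> - c"] C by linarith
  finally have mean: "\<bar>expectation f - c\<bar> \<le> C" .
  have "expectation (\<lambda>\<omega>. \<bar>f \<omega> - expectation f\<bar>) \<le> expectation (\<lambda>\<omega>. \<bar>f \<omega> - c\<bar> + \<bar>expectation f - c\<bar>)"
    using f by (intro integral_mono) auto
  also have "\<dots> = expectation (\<lambda>\<omega>. \<bar>f \<omega> - c\<bar>) + \<bar>expectation f - c\<bar>"
    using f by (simp add: prob_space)
  finally have "expectation (\<lambda>\<omega>. \<bar>f \<omega> - expectation f\<bar>) \<le> 2 * C"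
    using C mean by linarith
  moreover have "\<P>(\<omega> in M. a \<le> \<bar>f \<omega> - expectation f\<bar>) \<le> expectation (\<lambda>\<omega>. \<bar>f \<omega> - expectation f\<bar>) / a"
    using f a by (intro integral_Markov_inequality_measure[where A = "{}"]) auto
  ultimately show ?thesis using a by (meson divide_right_mono less_imp_le order_trans)
qed

text \<open>The bound is uniform in \<open>a\<close>, which lets \<open>a\<close> vary with
  \<open>N\<close> in the application to \<open>\<bar>x\<bar> * \<phi> N\<close>.\<close>

lemma bd_height_deviation:
  assumes \<mu>: "\<mu> > 0" and \<nu>: "\<nu> > 0" and i: "1 \<le> i"
    and H: "\<And>N. 1 \<le> N \<Longrightarrow> bd_height \<mu> \<nu> N (M N) (X N) i (H N)"
  shows "\<exists>C. \<forall>\<^sub>F N in sequentially. \<forall>a>0.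
    \<P>(\<omega> in M N. a \<le> \<bar>real (H N \<omega>) - (\<integral>\<omega>'. real (H N \<omega>') \<partial>M N)\<bar>) \<le> C / a"
proof -
  obtain C where C: "\<forall>\<^sub>F N in sequentially. \<exists>c\<le>N.
    (\<Sum>m\<in>{c<..N}. 1 / bd_scale (\<nu> / \<mu>) N m) + (\<Sum>m\<in>{1..c}. 1 - 1 / bd_scale (\<nu> / \<mu>) N m) \<le> C"
    using bd_centre_bounded[of "\<nu> / \<mu>"] \<mu> \<nu> by auto
  have "\<forall>\<^sub>F N in sequentially. \<forall>a>0.
    \<P>(\<omega> in M N. a \<le> \<bar>real (H N \<omega>) - (\<integral>\<omega>'. real (H N \<omega>') \<partial>M N)\<bar>) \<le> 2 * C / a"
    using C eventually_ge_at_top[of 1]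
  proof eventually_elim
    case (elim N)
    then obtain c where c: "c \<le> N"
      "(\<Sum>m\<in>{c<..N}. 1 / bd_scale (\<nu> / \<mu>) N m) + (\<Sum>m\<in>{1..c}. 1 - 1 / bd_scale (\<nu> / \<mu>) N m) \<le> C"
      by blast
    note law = bd_height_law[OF \<mu> \<nu> elim(2) i H[OF elim(2)]]
    have [measurable]: "H N \<in> measurable (M N) (count_space UNIV)" and "prob_space (M N)"
      using H[OF elim(2)] by (auto simp: bd_height_def ctmc_def)
    then interpret prob_space "M N" by simp
    have "integrable (M N) (\<lambda>\<omega>. real (H N \<omega>))"
      by (rule integrable_const_bound[of _ "real N"]) (use law(1) in auto)
    moreover have "(\<integral>\<omega>. \<bar>real (H N \<omega>) - real c\<bar> \<partial>M N) \<le> C"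
      using c law(2) by (simp add: expectation_abs_diff_tail[OF _ law(1)])
    ultimately show ?case by (auto intro: prob_deviation_le[where c = "real c"])
  qed
  then show ?thesis by blast
qed

theorem theorem1p3:
  fixes \<mu> \<nu> :: real
    and M :: "nat \<Rightarrow> 'a measure"
    and X :: "nat \<Rightarrow> real \<Rightarrow> 'a \<Rightarrow> nat"
    and i :: nat
    and H :: "nat \<Rightarrow> 'a \<Rightarrow> nat"
    and \<phi> :: "nat \<Rightarrow> real"
    and x :: real
  assumes "\<mu> > 0" and "\<nu> > 0"
    and "i \<ge> 1"
    and "\<And>N. N \<ge> 1 \<Longrightarrow> bd_height \<mu> \<nu> N (M N) (X N) i (H N)"
    and "\<And>N. N \<ge> 1 \<Longrightarrow> \<phi> N > 0"
    and "(\<lambda>N. ln (real N) / \<phi> N) \<longlonglongrightarrow> 0"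
    and "x \<noteq> 0"
  shows "(\<lambda>N. \<P>(\<omega> in M N. (real (H N \<omega>) - (\<integral>\<omega>'. real (H N \<omega>') \<partial>M N)) / \<phi> N \<le> x))
           \<longlonglongrightarrow> (if x < 0 then 0 else 1)"
proof -
  let ?D = "\<lambda>N \<omega>. real (H N \<omega>) - (\<integral>\<omega>'. real (H N \<omega>') \<partial>M N)"
  let ?P = "\<lambda>N. \<P>(\<omega> in M N. ?D N \<omega> / \<phi> N \<le> x)"
  let ?Q = "\<lambda>N. \<P>(\<omega> in M N. \<bar>x\<bar> * \<phi> N \<le> \<bar>?D N \<omega>\<bar>)"
  obtain C where C: "\<forall>\<^sub>F N in sequentially. \<forall>a>0. \<P>(\<omega> in M N. a \<le> \<bar>?D N \<omega>\<bar>) \<le> C / a"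
    using bd_height_deviation[where M = M and H = H and X = X, OF assms(1-4)] by blast
  \<comment> \<open>For \<open>N \<ge> 3\<close> one has \<open>ln N \<ge> 1\<close>, so
    \<open>1 / \<phi> N\<close> is dominated by the quotient that tends to 0.\<close>
  have "(\<lambda>N. 1 / \<phi> N) \<longlonglongrightarrow> 0"
  proof (rule tendsto_sandwich[OF _ _ tendsto_const assms(6)])
    show "\<forall>\<^sub>F N in sequentially. 0 \<le> 1 / \<phi> N"
      using eventually_ge_at_top[of 1] by eventually_elim (use assms(5) in \<open>auto intro: less_imp_le\<close>)
    show "\<forall>\<^sub>F N in sequentially. 1 / \<phi> N \<le> ln (real N) / \<phi> N"
      using eventually_ge_at_top[of 3]
    proof eventually_elim
      case (elim N)
      have "exp 1 \<le> real N" using exp_le elim by linarith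
      then have "1 \<le> ln (real N)" using elim by (subst ln_ge_iff) auto
      then show ?case using assms(5)[of N] elim by (intro divide_right_mono) auto
    qed
  qed
  from tendsto_mult_left[OF this, of "C / \<bar>x\<bar>"]
  have bound: "(\<lambda>N. C / (\<bar>x\<bar> * \<phi> N)) \<longlonglongrightarrow> 0" by simp
  have Q: "?Q \<longlonglongrightarrow> 0"
  proof (rule tendsto_sandwich[OF _ _ tendsto_const bound])
    show "\<forall>\<^sub>F N in sequentially. ?Q N \<le> C / (\<bar>x\<bar> * \<phi> N)"
      using C eventually_ge_at_top[of 1] by eventually_elim (use assms(5,7) in simp)
  qed simp
  \<comment> \<open>For negative \<open>x\<close> the event itself forces a deviation of at least
    \<open>\<bar>x\<bar> * \<phi> N\<close>; for positive \<open>x\<close> its complement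
    does.\<close>
  have near: "\<forall>\<^sub>F N in sequentially. if x < 0 then ?P N \<le> ?Q N else 1 - ?Q N \<le> ?P N \<and> ?P N \<le> 1"
    using eventually_ge_at_top[of 1]
  proof eventually_elim
    case (elim N)
    have [measurable]: "H N \<in> measurable (M N) (count_space UNIV)" and "prob_space (M N)"
      using assms(4)[OF elim] by (auto simp: bd_height_def ctmc_def)
    then interpret prob_space "M N" by simp
    have \<phi>: "0 < \<phi> N" using assms(5) elim by simp
    show ?case
    proof (cases "x < 0")
      case True
      have "?P N \<le> ?Q N"
        by (intro finite_measure_mono) (use True \<phi> in \<open>auto simp: field_simps\<close>)
      then show ?thesis using True by simp
    next
      case False
      have "1 - ?P N = \<P>(\<omega> in M N. \<not> ?D N \<omega> / \<phi> N \<le> x)"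
        by (rule prob_neg[symmetric]) measurable
      also have "\<dots> \<le> ?Q N"
        by (intro finite_measure_mono) (use False \<phi> in \<open>auto simp: field_simps\<close>)
      finally show ?thesis using False by simp
    qed
  qed
  show ?thesis
  proof (cases "x < 0")
    case True
    have "?P \<longlonglongrightarrow> 0"
    proof (rule tendsto_sandwich[OF _ _ tendsto_const Q])
      show "\<forall>\<^sub>F N in sequentially. ?P N \<le> ?Q N" using near True by simp
    qed simp
    then show ?thesis using True by simp
  next
    case False
    have "?P \<longlonglongrightarrow> 1"
    proof (rule tendsto_sandwich)
      show "(\<lambda>N. 1 - ?Q N) \<longlonglongrightarrow> 1" using tendsto_diff[OF tendsto_const Q, of 1] by simp
      show "(\<lambda>_. 1::real) \<longlonglongrightarrow> 1" by simp
    qed (use near False in \<open>auto elim!: eventually_mono\<close>)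
    then show ?thesis using False by simp
  qed
qed

end
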